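(* Let $A\in\mathbb C^{n\times n}$, let $\lambda_0$ be a simple eigenvalue of $A$, and let $\varepsilon_0>0$ be as in the context. Given $\varepsilon\in(0,\varepsilon_0]$, consider the differential system $$\dot E=-S+\mathrm{Re}\langle E,S\rangle\,E,\qquad E\in\mathcal S_1,\qquad ( * )$$ where $S=S(E)=yy^HG^H+G^Hxx^H$ is defined in the context. Then: 1) The right-hand side of $( * )$ is antiparallel to the projection onto the tangent space $\mathcal T_E\mathcal S_1$ of the gradient of $|y^Hx|$ (as a function of $E$). More precisely, along solutions of $( * )$, $$\frac{\mathrm d}{\mathrm dt}|y^Hx|=-\varepsilon\,|y^Hx|\,\|S-\mathrm{Re}\langle E,S\rangle E\|_F^2 .$$ In particular, $\frac{\mathrm d}{\mathrm dt}|y^Hx|=0$ if and only if $\dot E=0$. 2) The matrix $S$ has rank $2$ if $|y^Hx|<1$, whereas $S=O$ (the zero matrix) if $|y^Hx|=1$. As a consequence, the equilibria of system $( * )$ for which $|y^Hx|<1$ (in particular, the minimizers of $|y^Hx|$) are rank-$2$ matrices.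
   Context: For $A,B\in\mathbb C^{n\times n}$, $\langle A,B\rangle=\mathrm{trace}(A^HB)$ and $\|A\|_F=\sqrt{\langle A,A\rangle}$. $\mathcal S_1=\{E\in\mathbb C^{n\times n}:\|E\|_F=1\}$, viewed as a sphere in the real Euclidean space $\mathbb C^{n\times n}$ with inner product $\mathrm{Re}\langle\cdot,\cdot\rangle$; gradients and orthogonal projections are with respect to this real inner product. $\lambda_0$ is a simple eigenvalue of $A$, and $\varepsilon_0>0$ is fixed (it exists by continuity) such that for every $\varepsilon\in[0,\varepsilon_0]$ and $E\in\mathcal S_1$ the matrix $A+\varepsilon E$ has a simple eigenvalue $\lambda=\lambda(\varepsilon,E)$ close to $\lambda_0$ (the continuous continuation of $\lambda_0$, with $\lambda(0,E)=\lambda_0$). For given $\varepsilon$ and $E$, $x$ and $y$ are right and left eigenvectors of $A+\varepsilon E$ associated to $\lambda$, i.e. $(A+\varepsilon E)x=\lambda x$, $y^H(A+\varepsilon E)=\lambda y^H$, normalized by $\|x\|_2=\|y\|_2=1$ (note $y^Hx\neq0$ since $\lambda$ is simple). For a singular matrix $M$ with a simple zero eigenvalue, its group inverse is the unique matrix $G$ with $MG=GM$, $GMG=G$, $MGM=M$. $G$ denotes the group inverse of $A+\varepsilon E-\lambda I$, and $S=yy^HG^H+G^Hxx^H$. *)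

theory Defs
  imports
    "HOL-Analysis.Analysis"
    "HOL-Computational_Algebra.Polynomial"
begin

type_synonym 'n cmat = "complex ^ 'n ^ 'n"
type_synonym 'n cvec = "complex ^ 'n"

definition vconj :: "'n::finite cvec \<Rightarrow> 'n cvec" where
  "vconj y = (\<chi> i. cnj (y $ i))"

definition ctranspose :: "'n::finite cmat \<Rightarrow> 'n cmat" where
  "ctranspose M = (\<chi> i j. cnj (M $ j $ i))"

text \<open>The scalar $y^H x$ and the matrix $x y^H$.\<close>

definition cinner :: "'n::finite cvec \<Rightarrow> 'n cvec \<Rightarrow> complex" where
  "cinner y x = (\<Sum>i\<in>UNIV. cnj (y $ i) * x $ i)"

definition outer :: "'n::finite cvec \<Rightarrow> 'n cvec \<Rightarrow> 'n cmat" where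
  "outer x y = (\<chi> i j. x $ i * cnj (y $ j))"

definition frob :: "'n::finite cmat \<Rightarrow> 'n cmat \<Rightarrow> complex" where
  "frob A B = trace (ctranspose A ** B)"

definition frob_norm :: "'n::finite cmat \<Rightarrow> real" where
  "frob_norm A = sqrt (Re (frob A A))"

text \<open>
  The Euclidean structure that the library puts on complex matrices is the real one of the
  Frobenius inner product; in particular the library gradient \<open>GDERIV\<close> is the gradient with
  respect to \<open>Re (frob _ _)\<close>.
\<close>

lemma inner_eq_Re_frob: "inner A B = Re (frob A B)"
proof -
  have "Re (frob A B) = (\<Sum>i\<in>UNIV. \<Sum>k\<in>UNIV. inner (A $ k $ i) (B $ k $ i))"
    by (simp add: frob_def trace_def ctranspose_def matrix_matrix_mult_def inner_complex_def)
  also have "\<dots> = (\<Sum>k\<in>UNIV. \<Sum>i\<in>UNIV. inner (A $ k $ i) (B $ k $ i))"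
    by (rule sum.swap)
  finally show ?thesis
    by (simp add: inner_vec_def)
qed

lemma norm_eq_frob_norm: "norm A = frob_norm A"
  by (simp add: frob_norm_def norm_eq_sqrt_inner inner_eq_Re_frob)

definition unit_sphere :: "'n::finite cmat set" where
  "unit_sphere = {E. frob_norm E = 1}"

definition tangent_space :: "'n::finite cmat \<Rightarrow> 'n cmat set" where
  "tangent_space E = {Z. Re (frob E Z) = 0}"

definition orth_projection :: "'n::finite cmat set \<Rightarrow> 'n cmat \<Rightarrow> 'n cmat" where
  "orth_projection T Z = (THE P. P \<in> T \<and> (\<forall>W\<in>T. Re (frob W (Z - P)) = 0))"

definition charpoly :: "'n::finite cmat \<Rightarrow> complex poly" where
  "charpoly M = det (mat [:0, 1:] - (\<chi> i j. [:M $ i $ j:]))"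

text \<open>Simple means of algebraic multiplicity one.\<close>

definition simple_eigenvalue :: "'n::finite cmat \<Rightarrow> complex \<Rightarrow> bool" where
  "simple_eigenvalue M \<mu> \<longleftrightarrow> order \<mu> (charpoly M) = 1"

definition right_eigenvector :: "'n::finite cmat \<Rightarrow> complex \<Rightarrow> 'n cvec \<Rightarrow> bool" where
  "right_eigenvector M \<mu> x \<longleftrightarrow> x \<noteq> 0 \<and> M *v x = \<mu> *s x"

definition left_eigenvector :: "'n::finite cmat \<Rightarrow> complex \<Rightarrow> 'n cvec \<Rightarrow> bool" where
  "left_eigenvector M \<mu> y \<longleftrightarrow> y \<noteq> 0 \<and> vconj y v* M = \<mu> *s vconj y"

definition is_group_inverse :: "'n::finite cmat \<Rightarrow> 'n cmat \<Rightarrow> bool" where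
  "is_group_inverse M G \<longleftrightarrow> M ** G = G ** M \<and> G ** M ** G = G \<and> M ** G ** M = M"

definition group_inverse :: "'n::finite cmat \<Rightarrow> 'n cmat" where
  "group_inverse M = (THE G. is_group_inverse M G)"

text \<open>
  Below, \<open>x\<close> and \<open>y\<close> choose a right and a left eigenvector for each pair of a matrix \<open>M\<close> and a
  simple eigenvalue \<open>\<mu>\<close>; they matter only up to unimodular factors.
  \<open>overlap x y M \<mu>\<close> is $|y^H x|$.
\<close>

definition eigvec_choice ::
    "('n::finite cmat \<Rightarrow> complex \<Rightarrow> 'n cvec) \<Rightarrow> ('n cmat \<Rightarrow> complex \<Rightarrow> 'n cvec) \<Rightarrow> bool" where
  "eigvec_choice x y \<longleftrightarrow> (\<forall>M \<mu>. simple_eigenvalue M \<mu> \<longrightarrow>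
     right_eigenvector M \<mu> (x M \<mu>) \<and> norm (x M \<mu>) = 1 \<and>
     left_eigenvector M \<mu> (y M \<mu>) \<and> norm (y M \<mu>) = 1)"

definition overlap ::
    "('n::finite cmat \<Rightarrow> complex \<Rightarrow> 'n cvec) \<Rightarrow> ('n cmat \<Rightarrow> complex \<Rightarrow> 'n cvec)
      \<Rightarrow> 'n cmat \<Rightarrow> complex \<Rightarrow> real" where
  "overlap x y M \<mu> = cmod (cinner (y M \<mu>) (x M \<mu>))"

definition S_matrix ::
    "('n::finite cmat \<Rightarrow> complex \<Rightarrow> 'n cvec) \<Rightarrow> ('n cmat \<Rightarrow> complex \<Rightarrow> 'n cvec)
      \<Rightarrow> 'n cmat \<Rightarrow> complex \<Rightarrow> 'n cmat" where
  "S_matrix x y M \<mu> = (let G = group_inverse (M - mat \<mu>) in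
     outer (y M \<mu>) (y M \<mu>) ** ctranspose G + ctranspose G ** outer (x M \<mu>) (x M \<mu>))"

text \<open>
  The perturbation size ranges over \<open>{0..\<epsilon>0}\<close>; \<open>lam \<epsilon> E\<close> is the continuous continuation of the
  simple eigenvalue \<open>lam0\<close> of \<open>A\<close> to the matrices \<open>A + \<epsilon> E\<close>, along which it stays simple.
\<close>

definition eigenvalue_continuation ::
    "'n::finite cmat \<Rightarrow> complex \<Rightarrow> real \<Rightarrow> (real \<Rightarrow> 'n cmat \<Rightarrow> complex) \<Rightarrow> bool" where
  "eigenvalue_continuation A lam0 \<epsilon>0 lam \<longleftrightarrow>
     continuous_on ({0..\<epsilon>0} \<times> unit_sphere) (\<lambda>(\<epsilon>, E). lam \<epsilon> E) \<and>
     (\<forall>E\<in>unit_sphere. lam 0 E = lam0) \<and>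
     (\<forall>\<epsilon>\<in>{0..\<epsilon>0}. \<forall>E\<in>unit_sphere. simple_eigenvalue (A + \<epsilon> *\<^sub>R E) (lam \<epsilon> E))"

text \<open>
  The gradient at a point of the sphere is the one in the ambient matrix space, so the
  eigenvalue, given on the sphere only, has to be continued to an open neighbourhood \<open>U\<close> of
  that point.
\<close>

definition ambient_continuation ::
    "'n::finite cmat \<Rightarrow> real \<Rightarrow> ('n cmat \<Rightarrow> complex) \<Rightarrow> 'n cmat
      \<Rightarrow> 'n cmat set \<Rightarrow> ('n cmat \<Rightarrow> complex) \<Rightarrow> bool" where
  "ambient_continuation A \<epsilon> lam E U \<Lambda> \<longleftrightarrow>
     open U \<and> E \<in> U \<and> continuous_on U \<Lambda> \<and>
     (\<forall>F\<in>U. simple_eigenvalue (A + \<epsilon> *\<^sub>R F) (\<Lambda> F)) \<and>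
     (\<forall>F\<in>U \<inter> unit_sphere. \<Lambda> F = lam F)"

definition flow_rhs :: "('n::finite cmat \<Rightarrow> 'n cmat) \<Rightarrow> 'n cmat \<Rightarrow> 'n cmat" where
  "flow_rhs S E = - S E + Re (frob E (S E)) *\<^sub>R E"

definition flow_solution ::
    "('n::finite cmat \<Rightarrow> 'n cmat) \<Rightarrow> real set \<Rightarrow> (real \<Rightarrow> 'n cmat) \<Rightarrow> bool" where
  "flow_solution S T \<gamma> \<longleftrightarrow> is_interval T \<and> interior T \<noteq> {} \<and>
     (\<forall>t\<in>T. \<gamma> t \<in> unit_sphere \<and>
        (\<gamma> has_vector_derivative flow_rhs S (\<gamma> t)) (at t within T))"

text \<open>Minimizers are local ones, which includes the global ones.\<close>

definition sphere_minimizer :: "('n::finite cmat \<Rightarrow> real) \<Rightarrow> 'n cmat \<Rightarrow> bool" where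
  "sphere_minimizer f E \<longleftrightarrow> E \<in> unit_sphere \<and>
     (\<exists>d>0. \<forall>F\<in>unit_sphere. frob_norm (F - E) < d \<longrightarrow> f E \<le> f F)"

end

theory Submission
  imports Defs "HOL-Computational_Algebra.Fundamental_Theorem_Algebra"
begin

text \<open>
  Let \<open>M = A + \<epsilon> E\<close>, let \<open>\<lambda>\<close> be its simple eigenvalue with unit right and left eigenvectors \<open>x\<close>
  and \<open>y\<close>, let \<open>G\<close> be the group inverse of \<open>M - \<lambda>\<close>, and write \<open>f\<close> for \<open>\<bar>y\<^sup>H x\<bar>\<close>.
  Everything rests on the eigenprojection \<open>P = x y\<^sup>H / (y\<^sup>H x)\<close>, which does not depend on the
  choice of the eigenvectors and whose Frobenius norm is \<open>1 / f\<close>.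

  Simplicity of \<open>\<lambda>\<close>, in the sense of the characteristic polynomial, implies \<open>y\<^sup>H x \<noteq> 0\<close>
  (\<open>simple_eigenvalue_cinner_nonzero\<close>).  It follows that \<open>M - \<lambda> + P\<close> is invertible, which
  produces \<open>G\<close> together with \<open>G (M - \<lambda>) = (M - \<lambda>) G = 1 - P\<close> and \<open>G P = P G = 0\<close>
  (\<open>group_inverse_spectral_pair\<close>).  These equations and the rank one of \<open>P\<close> give, for another matrix
  \<open>M + H\<close> whose eigenvalue is close to \<open>\<lambda>\<close>, that its eigenprojection is
  \<open>P - G H P - P H G\<close> up to a remainder quadratic in \<open>H\<close> (\<open>norm_remainder_le\<close>).  So \<open>P\<close> is
  differentiable along any continuous choice of the eigenvalue, and differentiating
  \<open>f = 1 / norm P\<close> gives the gradient \<open>\<epsilon> f S\<close> with respect to \<open>E\<close> (\<open>gderiv_overlap\<close>).  A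
  continuous choice of the eigenvalue near \<open>E\<close>, off the sphere, exists because the
  characteristic polynomial has exactly one root near a simple root when the matrix varies a
  little (\<open>simple_eigenvalue_branch\<close>).

  The right-hand side of the flow is minus the tangential part of \<open>S\<close>; the first part of the
  theorem is then the chain rule.  For the rank, \<open>S = y (G y)\<^sup>H + (G\<^sup>H x) x\<^sup>H\<close>.  If \<open>f = 1\<close>, then
  \<open>x\<close> and \<open>y\<close> are parallel and \<open>G x = 0\<close>, \<open>G\<^sup>H y = 0\<close> make both terms vanish; if \<open>f < 1\<close>, the
  vectors \<open>G y\<close>, \<open>x\<close> are independent, and so are \<open>G\<^sup>H x\<close>, \<open>y\<close> (\<open>rank_S_matrix\<close>).  At an
  equilibrium \<open>S\<close> is a real multiple of \<open>E\<close>, whence the rank of \<open>E\<close>.  A minimizer is an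
  equilibrium, as the flow decreases \<open>f\<close>.  It cannot have \<open>f = 1\<close> in dimension at least two,
  since \<open>P\<close> would stay Hermitian in a neighbourhood on the sphere, contrary to the formula for its
  derivative (\<open>minimizer_less_1\<close>).
\<close>

section \<open>Complex matrices and the Frobenius norm\<close>

lemma matrix_mul_diff_left: "(A - B) ** C = A ** C - B ** (C :: 'n::finite cmat)"
  by (simp add: matrix_matrix_mult_def vec_eq_iff sum_subtractf left_diff_distrib)

lemma matrix_mul_diff_right: "A ** (B - C) = A ** B - A ** (C :: 'n::finite cmat)"
  by (simp add: matrix_matrix_mult_def vec_eq_iff sum_subtractf right_diff_distrib)

lemma matrix_mul_minus_left: "(- A) ** B = - (A ** (B :: 'n::finite cmat))"
  by (simp add: matrix_matrix_mult_def vec_eq_iff sum_negf)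

lemma matrix_mul_minus_right: "A ** (- B) = - (A ** (B :: 'n::finite cmat))"
  by (simp add: matrix_matrix_mult_def vec_eq_iff sum_negf)

lemma matrix_mul_zero_left: "0 ** A = (0 :: 'n::finite cmat)"
  by (simp add: matrix_matrix_mult_def vec_eq_iff)

lemma matrix_mul_zero_right: "A ** 0 = (0 :: 'n::finite cmat)"
  by (simp add: matrix_matrix_mult_def vec_eq_iff)

lemma matrix_mul_scaleR_left: "(c *\<^sub>R A) ** B = c *\<^sub>R (A ** (B :: 'n::finite cmat))"
  by (simp add: matrix_matrix_mult_def vec_eq_iff scaleR_sum_right)

lemma matrix_mul_scaleR_right: "A ** (c *\<^sub>R B) = c *\<^sub>R (A ** (B :: 'n::finite cmat))"
  by (simp add: matrix_matrix_mult_def vec_eq_iff scaleR_sum_right)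

lemma matrix_mul_add_left: "(A + B) ** C = A ** C + B ** (C :: 'n::finite cmat)"
  by (simp add: matrix_matrix_mult_def vec_eq_iff sum.distrib distrib_right)

lemmas matrix_ring_simps = matrix_add_ldistrib matrix_mul_add_left matrix_mul_diff_left
  matrix_mul_diff_right matrix_mul_minus_left matrix_mul_minus_right matrix_mul_zero_left
  matrix_mul_zero_right matrix_mul_assoc

lemma mat_mul: "(mat c ** A) $ i $ j = c * (A :: 'n::finite cmat) $ i $ j"
proof -
  have "(mat c ** A) $ i $ j = (\<Sum>k\<in>UNIV. (if i = k then c else 0) * A $ k $ j)"
    by (simp add: matrix_matrix_mult_def mat_def)
  also have "\<dots> = (\<Sum>k\<in>UNIV. if i = k then c * A $ k $ j else 0)"
    by (rule sum.cong) auto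
  finally show ?thesis by simp
qed

lemma mul_mat: "((A :: 'n::finite cmat) ** mat c) $ i $ j = c * A $ i $ j"
proof -
  have "(A ** mat c) $ i $ j = (\<Sum>k\<in>UNIV. A $ i $ k * (if k = j then c else 0))"
    by (simp add: matrix_matrix_mult_def mat_def)
  also have "\<dots> = (\<Sum>k\<in>UNIV. if k = j then c * A $ i $ k else 0)"
    by (rule sum.cong) auto
  finally show ?thesis by simp
qed

lemma mat_mul_commute: "mat c ** A = A ** mat c" for A :: "'n::finite cmat"
  by (simp add: vec_eq_iff mat_mul mul_mat)

lemma mat_mul_vec: "mat c *v v = c *s (v :: 'n::finite cvec)"
  using mat_mul by (simp add: vec_eq_iff matrix_vector_mult_def mat_def if_distrib if_distribR cong: if_cong)

lemma mat_diff: "mat a - mat b = (mat (a - b) :: 'n::finite cmat)"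
  by (simp add: vec_eq_iff mat_def)

lemma matrix_mul_vec_scale: "A *v (c *s v) = c *s (A *v (v :: 'n::finite cvec))"
  by (rule vec.scale)

lemma norm_cmat_squared: "(norm (A :: 'n::finite cmat))\<^sup>2 = (\<Sum>i\<in>UNIV. \<Sum>j\<in>UNIV. (cmod (A $ i $ j))\<^sup>2)"
  by (simp add: norm_vec_def L2_set_def sum_nonneg)

lemma norm_cvec_squared: "(norm (x :: 'n::finite cvec))\<^sup>2 = (\<Sum>i\<in>UNIV. (cmod (x $ i))\<^sup>2)"
  by (simp add: norm_vec_def L2_set_def sum_nonneg)

lemma norm_mat_mul: "norm (mat c ** A) = cmod c * norm (A :: 'n::finite cmat)"
proof -
  have "(norm (mat c ** A))\<^sup>2 = (cmod c * norm A)\<^sup>2"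
    by (simp add: norm_cmat_squared power_mult_distrib mat_mul norm_mult sum_distrib_left)
  then show ?thesis
    by (simp add: power2_eq_iff_nonneg)
qed

text \<open>Cauchy--Schwarz in each entry makes the Frobenius norm submultiplicative.\<close>

lemma norm_matrix_mul_le: "norm (A ** B) \<le> norm A * norm B" for A B :: "'n::finite cmat"
proof -
  have entry: "(cmod ((A ** B) $ i $ j))\<^sup>2
      \<le> (\<Sum>k\<in>UNIV. (cmod (A $ i $ k))\<^sup>2) * (\<Sum>k\<in>UNIV. (cmod (B $ k $ j))\<^sup>2)" for i j
  proof -
    have "cmod ((A ** B) $ i $ j) \<le> (\<Sum>k\<in>UNIV. cmod (A $ i $ k) * cmod (B $ k $ j))"
      by (simp add: matrix_matrix_mult_def norm_mult[symmetric] norm_sum)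
    then have "(cmod ((A ** B) $ i $ j))\<^sup>2 \<le> (\<Sum>k\<in>UNIV. cmod (A $ i $ k) * cmod (B $ k $ j))\<^sup>2"
      by (simp add: power_mono)
    also have "\<dots> \<le> (\<Sum>k\<in>UNIV. (cmod (A $ i $ k))\<^sup>2) * (\<Sum>k\<in>UNIV. (cmod (B $ k $ j))\<^sup>2)"
      by (rule Cauchy_Schwarz_ineq_sum)
    finally show ?thesis .
  qed
  have "(norm (A ** B))\<^sup>2 \<le> (\<Sum>i\<in>UNIV. \<Sum>j\<in>UNIV.
      (\<Sum>k\<in>UNIV. (cmod (A $ i $ k))\<^sup>2) * (\<Sum>k\<in>UNIV. (cmod (B $ k $ j))\<^sup>2))"
    unfolding norm_cmat_squared by (intro sum_mono entry)
  also have "\<dots> = (norm A)\<^sup>2 * (\<Sum>j\<in>UNIV. \<Sum>k\<in>UNIV. (cmod (B $ k $ j))\<^sup>2)"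
    by (simp add: norm_cmat_squared sum_product)
  also have "(\<Sum>j\<in>UNIV. \<Sum>k\<in>UNIV. (cmod (B $ k $ j))\<^sup>2) = (norm B)\<^sup>2"
    unfolding norm_cmat_squared by (rule sum.swap)
  finally have "(norm (A ** B))\<^sup>2 \<le> (norm A * norm B)\<^sup>2"
    by (simp add: power_mult_distrib)
  then show ?thesis
    by (simp add: abs_le_square_iff[symmetric])
qed

lemma norm_matrix_vector_mul_le: "norm (A *v x) \<le> norm A * norm x" for A :: "'n::finite cmat"
proof -
  have entry: "(cmod ((A *v x) $ i))\<^sup>2
      \<le> (\<Sum>k\<in>UNIV. (cmod (A $ i $ k))\<^sup>2) * (norm x)\<^sup>2" for i
  proof -
    have "cmod ((A *v x) $ i) \<le> (\<Sum>k\<in>UNIV. cmod (A $ i $ k) * cmod (x $ k))"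
      by (simp add: matrix_vector_mult_def norm_mult[symmetric] norm_sum)
    then have "(cmod ((A *v x) $ i))\<^sup>2 \<le> (\<Sum>k\<in>UNIV. cmod (A $ i $ k) * cmod (x $ k))\<^sup>2"
      by (simp add: power_mono)
    also have "\<dots> \<le> (\<Sum>k\<in>UNIV. (cmod (A $ i $ k))\<^sup>2) * (\<Sum>k\<in>UNIV. (cmod (x $ k))\<^sup>2)"
      by (rule Cauchy_Schwarz_ineq_sum)
    finally show ?thesis by (simp add: norm_cvec_squared)
  qed
  have "(norm (A *v x))\<^sup>2 \<le> (\<Sum>i\<in>UNIV. (\<Sum>k\<in>UNIV. (cmod (A $ i $ k))\<^sup>2) * (norm x)\<^sup>2)"
    unfolding norm_cvec_squared[of "A *v x"] by (intro sum_mono entry)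
  also have "\<dots> = (norm A * norm x)\<^sup>2"
    by (simp add: norm_cmat_squared power_mult_distrib sum_distrib_right)
  finally show ?thesis
    by (simp add: abs_le_square_iff[symmetric])
qed

lemma norm_matrix_mul_le3: "norm (A ** B ** C) \<le> norm A * norm B * norm C" for A B C :: "'n::finite cmat"
  by (meson norm_matrix_mul_le order_trans mult_right_mono norm_ge_zero)

lemma ctranspose_nth [simp]: "ctranspose A $ i $ j = cnj (A $ j $ i)"
  by (simp add: ctranspose_def)

lemma ctranspose_ctranspose [simp]: "ctranspose (ctranspose A) = A"
  by (simp add: vec_eq_iff)

lemma ctranspose_mul: "ctranspose (A ** B) = ctranspose B ** ctranspose A"
  by (simp add: vec_eq_iff matrix_matrix_mult_def mult.commute)

lemma ctranspose_add: "ctranspose (A + B) = ctranspose A + ctranspose B"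
  by (simp add: vec_eq_iff)

lemma ctranspose_minus: "ctranspose (- A) = - ctranspose A"
  by (simp add: vec_eq_iff)

lemma ctranspose_diff: "ctranspose (A - B) = ctranspose A - ctranspose B"
  by (simp add: vec_eq_iff)

lemma ctranspose_scaleR: "ctranspose (c *\<^sub>R A) = c *\<^sub>R ctranspose A"
  by (simp add: vec_eq_iff)

lemma ctranspose_mat: "ctranspose (mat c) = mat (cnj c)"
  by (auto simp: vec_eq_iff mat_def)

lemma linear_ctranspose: "linear ctranspose"
  by (intro linearI ctranspose_add ctranspose_scaleR)

lemma cinner_add_right: "cinner x (y + z) = cinner x y + cinner x z"
  by (simp add: cinner_def sum.distrib distrib_left)

lemma cinner_diff_left: "cinner (x - y) z = cinner x z - cinner y z"
  by (simp add: cinner_def sum_subtractf left_diff_distrib)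

lemma cinner_diff_right: "cinner x (y - z) = cinner x y - cinner x z"
  by (simp add: cinner_def sum_subtractf right_diff_distrib)

lemma cinner_scale_left: "cinner (c *s x) y = cnj c * cinner x y"
  by (simp add: cinner_def sum_distrib_left mult.assoc)

lemma cinner_scale_right: "cinner x (c *s y) = c * cinner x y"
  by (simp add: cinner_def sum_distrib_left mult_ac)

lemma cinner_zero [simp]: "cinner 0 x = 0" "cinner x 0 = 0"
  by (simp_all add: cinner_def)

lemma cnj_cinner: "cnj (cinner x y) = cinner y x"
  by (simp add: cinner_def mult.commute)

lemma cinner_self: "cinner x x = complex_of_real ((norm x)\<^sup>2)"
  by (simp add: cinner_def norm_cvec_squared complex_norm_square of_real_sum mult.commute del: of_real_power)

lemma cinner_self_eq_0 [simp]: "cinner x x = 0 \<longleftrightarrow> x = 0"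
  by (simp add: cinner_self)

lemma cinner_mul_right: "cinner x (A *v y) = cinner (ctranspose A *v x) y"
proof -
  have "cinner x (A *v y) = (\<Sum>i\<in>UNIV. \<Sum>j\<in>UNIV. cnj (x $ i) * (A $ i $ j * y $ j))"
    by (simp add: cinner_def matrix_vector_mult_def sum_distrib_left)
  also have "\<dots> = (\<Sum>j\<in>UNIV. \<Sum>i\<in>UNIV. cnj (x $ i) * (A $ i $ j * y $ j))"
    by (rule sum.swap)
  also have "\<dots> = cinner (ctranspose A *v x) y"
    by (simp add: cinner_def matrix_vector_mult_def sum_distrib_right sum_distrib_left mult_ac)
  finally show ?thesis .
qed

lemma norm_vec_scale: "norm (c *s x) = cmod c * norm (x :: 'n::finite cvec)"
proof -
  have "(norm (c *s x))\<^sup>2 = (cmod c * norm x)\<^sup>2"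
    by (simp add: norm_cvec_squared power_mult_distrib norm_mult sum_distrib_left)
  then show ?thesis
    by (simp add: power2_eq_iff_nonneg)
qed

lemma outer_nth [simp]: "outer x y $ i $ j = x $ i * cnj (y $ j)"
  by (simp add: outer_def)

lemma ctranspose_outer: "ctranspose (outer x y) = outer y x"
  by (simp add: vec_eq_iff mult.commute)

lemma mul_outer: "A ** outer x y = outer (A *v x) y"
  for A :: "'n::finite cmat"
  by (simp add: vec_eq_iff matrix_matrix_mult_def matrix_vector_mult_def sum_distrib_right mult.assoc)

lemma outer_mul: "outer x y ** A = outer x (ctranspose A *v y)"
  by (simp add: vec_eq_iff matrix_matrix_mult_def matrix_vector_mult_def sum_distrib_left mult_ac)

lemma outer_mul_vec: "outer x y *v z = cinner y z *s x"
  by (simp add: vec_eq_iff matrix_vector_mult_def cinner_def sum_distrib_left sum_distrib_right mult_ac)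

lemma outer_mul_outer: "outer u y ** outer v z = mat (cinner y v) ** outer u z"
  by (simp add: mul_outer outer_mul_vec mat_mul_vec)

lemma outer_sandwich:
  "outer u y ** outer v z ** outer u y = mat (cinner y v * cinner z u) ** outer u y"
proof -
  have "outer u y ** outer v z ** outer u y = mat (cinner y v) ** (mat (cinner z u) ** outer u y)"
    by (simp add: outer_mul_outer matrix_mul_assoc[symmetric])
  then show ?thesis
    by (simp add: vec_eq_iff mat_mul)
qed

lemma norm_outer: "norm (outer x y) = norm x * norm y"
proof -
  have "(norm (outer x y))\<^sup>2 = (norm x * norm y)\<^sup>2"
    by (simp add: norm_cmat_squared norm_cvec_squared power_mult_distrib norm_mult sum_product)
  then show ?thesis
    by (simp add: power2_eq_iff_nonneg)
qed

lemma inner_matrix_mul_left: "inner A (B ** C) = inner (ctranspose B ** A) C" for A B C :: "'n::finite cmat"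
  by (simp add: inner_eq_Re_frob frob_def ctranspose_mul matrix_mul_assoc)

lemma inner_matrix_mul_right: "inner A (B ** C) = inner (A ** ctranspose C) B" for A B C :: "'n::finite cmat"
proof -
  have "trace (ctranspose A ** B ** C) = trace (C ** (ctranspose A ** B))"
    by (rule trace_mul_sym)
  then show ?thesis
    by (simp add: inner_eq_Re_frob frob_def ctranspose_mul matrix_mul_assoc)
qed

lemma left_eigenvector_iff:
  "left_eigenvector M \<mu> y \<longleftrightarrow> y \<noteq> 0 \<and> ctranspose M *v y = cnj \<mu> *s y"
proof -
  have "vconj y v* M = \<mu> *s vconj y \<longleftrightarrow> ctranspose M *v y = cnj \<mu> *s y" 
  proof -
    have "(vconj y v* M) $ j = \<mu> * cnj (y $ j) \<longleftrightarrow> (ctranspose M *v y) $ j = cnj \<mu> * y $ j" for j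
    proof -
      have "(ctranspose M *v y) $ j = cnj ((vconj y v* M) $ j)"
        by (simp add: vconj_def vector_matrix_mult_def matrix_vector_mult_def mult.commute)
      then show ?thesis
        by (metis complex_cnj_cnj complex_cnj_mult)
    qed
    then show ?thesis
      by (simp add: vec_eq_iff vconj_def)
  qed
  then show ?thesis
    by (simp add: left_eigenvector_def)
qed

text \<open>
  For unit vectors, the squared distance of \<open>y\<close> from its projection \<open>(x\<^sup>H y) x\<close> is
  \<open>1 - \<bar>y\<^sup>H x\<bar>\<^sup>2\<close>.
\<close>

lemma
  assumes "norm x = 1" "norm y = 1"
  shows cmod_cinner_le_1: "cmod (cinner y x) \<le> 1"
    and cmod_cinner_eq_1_iff: "cmod (cinner y x) = 1 \<longleftrightarrow> y = cinner x y *s x"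
proof -
  have "cinner x x = 1" "cinner y y = 1"
    using assms by (simp_all add: cinner_self)
  then have "cinner (y - cinner x y *s x) (y - cinner x y *s x)
      = 1 - cinner y x * cnj (cinner y x)"
    by (simp add: cinner_diff_left cinner_diff_right cinner_scale_left
        cinner_scale_right cnj_cinner algebra_simps)
  then have eq: "(norm (y - cinner x y *s x))\<^sup>2 = 1 - (cmod (cinner y x))\<^sup>2"
    by (metis cinner_self complex_norm_square of_real_1 of_real_diff of_real_eq_iff of_real_power)
  then have "(cmod (cinner y x))\<^sup>2 \<le> 1\<^sup>2"
    by (smt (verit) one_power2 zero_le_power2)
  then show "cmod (cinner y x) \<le> 1"
    by (simp add: abs_square_le_1)
  have "cmod (cinner y x) = 1 \<longleftrightarrow> (cmod (cinner y x))\<^sup>2 = 1"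
    by (simp add: power2_eq_1_iff) (smt (verit) norm_ge_zero)
  also have "\<dots> \<longleftrightarrow> y - cinner x y *s x = 0"
    using eq by (metis diff_eq_diff_less_eq eq_iff_diff_eq_0 norm_eq_zero order_refl zero_eq_power2)
  finally show "cmod (cinner y x) = 1 \<longleftrightarrow> y = cinner x y *s x"
    by simp
qed

section \<open>Simple eigenvalues, eigenprojections and group inverses\<close>

lemma singular_imp_kernel:
  fixes A :: "'n::finite cmat"
  assumes "det A = 0"
  obtains v where "v \<noteq> 0" "A *v v = 0"
  using assms by (metis invertible_det_nz invertible_left_inverse matrix_left_invertible_ker)

lemma kernel_imp_singular:
  fixes A :: "'n::finite cmat"
  assumes "v \<noteq> 0" "A *v v = 0"
  shows "det A = 0"
  using assms by (metis invertible_det_nz invertible_left_inverse matrix_left_invertible_ker)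

lemma poly_charpoly: "poly (charpoly M) t = det (mat t - M)"
proof -
  have "poly ((mat [:0, 1:] - (\<chi> i j. [:M $ i $ j:])) $ i $ j) t = (mat t - M) $ i $ j" for i j
    by (simp add: mat_def)
  then show ?thesis
    by (simp add: charpoly_def det_def poly_sum poly_prod)
qed

text \<open>
  A matrix with vanishing characteristic polynomial would have arbitrarily large eigenvalues,
  but eigenvalues are bounded by the norm.
\<close>

lemma charpoly_nonzero: "charpoly M \<noteq> 0"
proof
  assume "charpoly M = 0"
  define t where "t = complex_of_real (norm M + 1)"
  have "det (mat t - M) = 0"
    using \<open>charpoly M = 0\<close> poly_charpoly[of M t] by simp
  then obtain v where v: "v \<noteq> 0" "(mat t - M) *v v = 0"
    by (rule singular_imp_kernel)
  then have "M *v v = t *s v"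
    by (simp add: matrix_vector_mult_diff_rdistrib mat_mul_vec)
  then have "cmod t * norm v \<le> norm M * norm v"
    by (metis norm_matrix_vector_mul_le norm_vec_scale)
  then have "cmod t \<le> norm M"
    using v by simp
  moreover have "cmod t = norm M + 1"
    unfolding t_def norm_of_real by simp
  ultimately show False
    by simp
qed

lemma simple_eigenvalue_iff:
  "simple_eigenvalue M \<mu> \<longleftrightarrow> det (mat \<mu> - M) = 0 \<and> poly (pderiv (charpoly M)) \<mu> \<noteq> 0"
proof (cases "det (mat \<mu> - M) = 0")
  case True
  then have "order \<mu> (charpoly M) = Suc (order \<mu> (pderiv (charpoly M)))"
    by (intro order_pderiv charpoly_nonzero) (simp add: poly_charpoly)
  moreover have "pderiv (charpoly M) \<noteq> 0"
  proof
    assume "pderiv (charpoly M) = 0"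
    then obtain c where "charpoly M = [:c:]"
      by (metis degree_eq_zeroE pderiv_eq_0_iff)
    then show False
      using True charpoly_nonzero[of M] poly_charpoly[of M \<mu>] by simp
  qed
  ultimately show ?thesis
    using True by (simp add: simple_eigenvalue_def order_root)
next
  case False
  then have "order \<mu> (charpoly M) = 0"
    by (metis poly_charpoly order_root)
  then show ?thesis
    using False by (simp add: simple_eigenvalue_def)
qed

lemma isCont_det:
  fixes A :: "'a::t2_space \<Rightarrow> 'n::finite cmat"
  assumes "\<And>i j. isCont (\<lambda>t. A t $ i $ j) a"
  shows "isCont (\<lambda>t. det (A t)) a"
  unfolding det_def by (intro continuous_intros assms)

text \<open>
  Replacing one row of \<open>t - M\<close> by \<open>y\<^sup>H\<close> extracts the factor \<open>t - \<mu>\<close> from the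
  characteristic polynomial.  If \<open>y\<^sup>H x = 0\<close>, the matrix with the new row still annihilates \<open>x\<close>
  at \<open>t = \<mu>\<close>, so that its determinant vanishes there and \<open>\<mu>\<close> is a multiple root.
\<close>

lemma simple_eigenvalue_cinner_nonzero:
  fixes M :: "'n::finite cmat"
  assumes simple: "simple_eigenvalue M \<mu>"
    and x: "M *v x = \<mu> *s x" "x \<noteq> 0" and y: "ctranspose M *v y = cnj \<mu> *s y" "y \<noteq> 0"
  shows "cinner y x \<noteq> 0"
proof
  assume "cinner y x = 0"
  define w where "w = vconj y"
  have "w \<noteq> 0"
    using y by (simp add: w_def vconj_def vec_eq_iff)
  then obtain k where k: "w $ k \<noteq> 0"
    by (auto simp: vec_eq_iff)
  define C where "C t = (\<chi> i. if i = k then w else row i (mat t - M))" for t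
  have "left_eigenvector M \<mu> y"
    using y by (simp add: left_eigenvector_iff)
  then have wM: "w v* M = \<mu> *s w"
    by (simp add: left_eigenvector_def w_def)
  have "w v* mat t = t *s w" for t
    by (simp add: vec_eq_iff vector_matrix_mult_def mat_def if_distrib if_distribR cong: if_cong)
  with wM have "w v* (mat t - M) = (t - \<mu>) *s w" for t
    by (simp add: vector_matrix_mult_diff_rdistrib vector_matrix_mult_diff_distrib 
        vector_sub_rdistrib)
  moreover have "w v* A = (\<Sum>i\<in>UNIV. w $ i *s row i A)" for A :: "'n cmat"
    by (simp add: vec_eq_iff vector_matrix_mult_def row_def mult.commute)
  ultimately have row: "(\<Sum>i\<in>UNIV. w $ i *s row i (mat t - M)) = (t - \<mu>) *s w" for t
    by metis
  have factor: "w $ k * poly (charpoly M) t = (t - \<mu>) * det (C t)" for t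
    using cramer_lemma_transpose[of k w "mat t - M"]
    by (simp only: row det_row_mul poly_charpoly C_def)
  have "isCont (\<lambda>t. det (C t)) \<mu>"
  proof (rule isCont_det)
    show "isCont (\<lambda>t. C t $ i $ j) \<mu>" for i j
      by (cases "i = k"; cases "i = j") (simp_all add: C_def row_def mat_def)
  qed
  moreover have "poly (charpoly M) \<mu> = 0"
    using factor[of \<mu>] k by simp
  \<comment> \<open>The continuous cofactor \<open>det (C t)\<close> of \<open>t - \<mu>\<close> is the difference quotient at \<open>\<mu>\<close>.\<close>
  ultimately have "((\<lambda>t. w $ k * poly (charpoly M) t) has_field_derivative det (C \<mu>)) (at \<mu>)"
    unfolding CARAT_DERIV using factor by (intro exI[of _ "\<lambda>t. det (C t)"]) simp
  moreover have "((\<lambda>t. w $ k * poly (charpoly M) t) has_field_derivative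
      w $ k * poly (pderiv (charpoly M)) \<mu>) (at \<mu>)"
    by (auto intro!: derivative_eq_intros)
  ultimately have "w $ k * poly (pderiv (charpoly M)) \<mu> = det (C \<mu>)"
    by (rule DERIV_unique[symmetric])
  moreover have "C \<mu> *v x = 0"
  proof -
    have "(C \<mu> *v x) $ i = 0" for i
    proof (cases "i = k")
      case True
      then show ?thesis
        using \<open>cinner y x = 0\<close> by (simp add: C_def w_def vconj_def matrix_vector_mult_def cinner_def)
    next
      case False
      have "((mat \<mu> - M) *v x) $ i = 0"
        by (simp add: matrix_vector_mult_diff_rdistrib mat_mul_vec x)
      with False show ?thesis
        by (simp add: C_def row_def matrix_vector_mult_def)
    qed
    then show ?thesis
      by (simp add: vec_eq_iff)
  qed
  then have "det (C \<mu>) = 0"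
    using kernel_imp_singular \<open>x \<noteq> 0\<close> by blast
  ultimately have "poly (pderiv (charpoly M)) \<mu> = 0"
    using k by simp
  then show False
    using simple by (simp add: simple_eigenvalue_iff)
qed

text \<open>
  Otherwise the difference of the two sides would be an eigenvector annihilated by \<open>y\<^sup>H\<close>.
\<close>

lemma simple_eigenvector_unique:
  fixes M :: "'n::finite cmat"
  assumes simple: "simple_eigenvalue M \<mu>"
    and x: "M *v x = \<mu> *s x" "x \<noteq> 0" and y: "ctranspose M *v y = cnj \<mu> *s y" "y \<noteq> 0"
    and v: "M *v v = \<mu> *s v"
  shows "v = (cinner y v / cinner y x) *s x"
proof (rule ccontr)
  let ?c = "cinner y v / cinner y x"
  assume "v \<noteq> ?c *s x"
  then have "v - ?c *s x \<noteq> 0"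
    by simp
  moreover have "M *v (v - ?c *s x) = \<mu> *s (v - ?c *s x)"
    by (simp add: matrix_vector_mult_diff_distrib matrix_mul_vec_scale v x vec.scale_right_diff_distrib
        mult.commute)
  ultimately have "cinner y (v - ?c *s x) \<noteq> 0"
    by (intro simple_eigenvalue_cinner_nonzero[OF simple]) (use y in auto)
  then show False
    using simple_eigenvalue_cinner_nonzero[OF simple x y]
    by (simp add: cinner_diff_right cinner_scale_right)
qed

text \<open>
  Here \<open>P\<close> is an idempotent onto eigenvectors for \<open>\<mu>\<close>, commuting with \<open>M\<close>, and \<open>G\<close> is the
  reduced resolvent: it inverts \<open>M - \<mu>\<close> on the kernel of \<open>P\<close> and vanishes on the range of
  \<open>P\<close>.
\<close>

definition spectral_pair :: "'n::finite cmat \<Rightarrow> complex \<Rightarrow> 'n cmat \<Rightarrow> 'n cmat \<Rightarrow> bool" where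
  "spectral_pair M \<mu> P G \<longleftrightarrow>
     P ** P = P \<and> M ** P = mat \<mu> ** P \<and> P ** M = mat \<mu> ** P \<and>
     G ** (M - mat \<mu>) = mat 1 - P \<and> (M - mat \<mu>) ** G = mat 1 - P \<and> G ** P = 0 \<and> P ** G = 0"

definition eigenprojection :: "'n::finite cvec \<Rightarrow> 'n cvec \<Rightarrow> 'n cmat" where
  "eigenprojection x y = outer (inverse (cinner y x) *s x) y"

text \<open>
  Two group inverses satisfy \<open>G' N = N G' N G = N G\<close>, hence \<open>G' = G' N G' = G N G' = G\<close>.
\<close>

lemma group_inverse_unique:
  fixes N :: "'n::finite cmat"
  assumes G: "is_group_inverse N G"
  shows "group_inverse N = G"
  unfolding group_inverse_def
proof (rule the_equality)
  show "is_group_inverse N G"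
    by (rule G)
next
  fix G' assume G': "is_group_inverse N G'"
  have c: "N ** G = G ** N" "N ** G' = G' ** N"
    and g: "G ** N ** G = G" "G' ** N ** G' = G'" and n: "N ** G ** N = N" "N ** G' ** N = N"
    using G G' by (auto simp: is_group_inverse_def)
  have "G' ** N = G' ** (N ** G ** N)"
    by (simp add: n)
  also have "\<dots> = (G' ** N) ** (G ** N)"
    by (simp add: matrix_mul_assoc)
  also have "\<dots> = (N ** G' ** N) ** G"
    by (simp add: c[symmetric] matrix_mul_assoc)
  also have "\<dots> = N ** G"
    by (simp add: n)
  finally have eq: "G' ** N = N ** G" .
  have "G' = G' ** N ** G'"
    by (simp add: g)
  also have "\<dots> = G ** (N ** G')"
    by (simp add: eq c(1) matrix_mul_assoc)
  also have "\<dots> = G ** (N ** G)"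
    by (simp add: c(2) eq)
  also have "\<dots> = G"
    by (simp add: g matrix_mul_assoc)
  finally show "G' = G" .
qed

text \<open>
  The group inverse is \<open>(N + P)\<^sup>-\<^sup>1 - P\<close> for \<open>N = M - \<mu>\<close>: the
  eigenprojection \<open>P\<close> fills up the kernel of \<open>N\<close> with the identity.
\<close>

lemma group_inverse_spectral_pair:
  fixes M :: "'n::finite cmat"
  assumes simple: "simple_eigenvalue M \<mu>"
    and x: "right_eigenvector M \<mu> x" and y: "left_eigenvector M \<mu> y"
  shows "spectral_pair M \<mu> (eigenprojection x y) (group_inverse (M - mat \<mu>))"
proof -
  have x': "M *v x = \<mu> *s x" "x \<noteq> 0" and y': "ctranspose M *v y = cnj \<mu> *s y" "y \<noteq> 0"
    using x y by (simp_all add: right_eigenvector_def left_eigenvector_iff)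
  have yx: "cinner y x \<noteq> 0"
    by (rule simple_eigenvalue_cinner_nonzero[OF simple x' y'])
  define u where "u = inverse (cinner y x) *s x"
  define N where "N = M - mat \<mu>"
  define P where "P = outer u y"
  have yu: "cinner y u = 1"
    using yx by (simp add: u_def cinner_scale_right)
  have Nx: "N *v x = 0"
    by (simp add: N_def matrix_vector_mult_diff_rdistrib mat_mul_vec x')
  have Ny: "ctranspose N *v y = 0"
    by (simp add: N_def ctranspose_diff ctranspose_mat matrix_vector_mult_diff_rdistrib mat_mul_vec y')
  have PP: "P ** P = P"
    by (simp add: P_def outer_mul_outer yu)
  have NP: "N ** P = 0"
    by (simp add: P_def mul_outer u_def matrix_mul_vec_scale Nx vec_eq_iff)
  have PN: "P ** N = 0"
    by (simp add: P_def outer_mul Ny vec_eq_iff)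
  have "v = 0" if "(N + P) *v v = 0" for v
  proof -
    have "cinner y (N *v v) = 0"
      by (simp add: cinner_mul_right Ny)
    then have yv: "cinner y v = 0"
      using arg_cong[OF that, of "cinner y"]
      by (simp add: matrix_vector_mult_add_rdistrib cinner_add_right P_def outer_mul_vec
          cinner_scale_right yu)
    then have "N *v v = 0"
      using that by (simp add: matrix_vector_mult_add_rdistrib P_def outer_mul_vec)
    then have "M *v v = \<mu> *s v"
      by (simp add: N_def matrix_vector_mult_diff_rdistrib mat_mul_vec)
    from simple_eigenvector_unique[OF simple x' y' this] yv show "v = 0"
      by simp
  qed
  then obtain C where CB: "C ** (N + P) = mat 1"
    using matrix_left_invertible_ker[of "N + P"] by blast
  then have BC: "(N + P) ** C = mat 1"
    using matrix_left_right_inverse by blast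
  have CP: "C ** P = P"
  proof -
    have "C ** (N + P) ** P = C ** P"
      by (simp add: matrix_mul_assoc[symmetric] matrix_mul_add_left NP PP)
    then show ?thesis
      by (simp add: CB)
  qed
  have PC: "P ** C = P"
  proof -
    have "P ** (N + P) ** C = P ** C"
      by (simp add: matrix_add_ldistrib PN PP)
    then show ?thesis
      by (metis BC matrix_mul_assoc matrix_mul_rid)
  qed
  define G where "G = C - P"
  have GN: "G ** N = mat 1 - P"
    using CB by (simp add: G_def matrix_mul_diff_left PN matrix_add_ldistrib CP eq_diff_eq)
  have NG: "N ** G = mat 1 - P"
    using BC by (simp add: G_def matrix_mul_diff_right NP matrix_mul_add_left PC eq_diff_eq)
  have GP: "G ** P = 0" "P ** G = 0"
    by (simp_all add: G_def matrix_mul_diff_right matrix_mul_diff_left CP PC PP)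
  have "is_group_inverse N G"
    by (simp add: is_group_inverse_def GN NG matrix_mul_diff_left GP PN)
  then have "group_inverse N = G"
    by (rule group_inverse_unique)
  moreover have "M ** P = mat \<mu> ** P" "P ** M = mat \<mu> ** P"
    using NP PN by (simp_all add: N_def matrix_mul_diff_left matrix_mul_diff_right mat_mul_commute)
  ultimately show ?thesis
    using PP GN NG GP by (simp add: spectral_pair_def eigenprojection_def P_def N_def u_def)
qed

section \<open>Perturbation of an eigenprojection\<close>

text \<open>
  A Lipschitz constant for the dependence of an eigenprojection of norm \<open>p\<close>, with reduced
  resolvent of norm \<open>g\<close>, on the matrix.
\<close>

definition projection_lipschitz :: "real \<Rightarrow> real \<Rightarrow> real" where
  "projection_lipschitz p g = 7 * p\<^sup>2 * g * (1 + 2 * p)"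

text \<open>
  A pair of matrices with rank-one eigenprojections \<open>P0\<close> and \<open>P\<close>.  The
  estimates below are uniform in \<open>P\<close>, with constants built from \<open>P0\<close> and the reduced resolvent
  \<open>G0\<close>; they bound \<open>P - P0\<close> and its distance from the linear term
  \<open>- G0 H P0 - P0 H G0\<close> in terms of \<open>H = M - M0\<close>, as soon as \<open>H\<close> and the shift of the
  eigenvalue are small.
\<close>

locale perturbed_eigenprojection =
  fixes M0 M P0 P G0 :: "'n::finite cmat" and \<mu>0 \<mu> :: complex and u0 y0 u y :: "'n cvec"
  assumes base: "spectral_pair M0 \<mu>0 P0 G0" "P0 = outer u0 y0" "cinner y0 u0 = 1"
    and perturbed: "M ** P = mat \<mu> ** P" "P ** M = mat \<mu> ** P" "P = outer u y" "cinner y u = 1"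
begin

definition "H = M - M0"
definition "m = \<mu> - \<mu>0"
definition "K = (M - mat \<mu>) - (M0 - mat \<mu>0)"
definition "\<delta> = norm G0 * (norm H + cmod m)"
definition "\<tau> = cinner y u0 * cinner y0 u"

lemma K_eq: "K = H - mat m"
  by (simp add: K_def H_def m_def mat_diff[symmetric])

lemma idem: "P0 ** P0 = P0" "P ** P = P" and G0_P0: "G0 ** P0 = 0" "P0 ** G0 = 0"
  using base perturbed by (auto simp: spectral_pair_def outer_mul_outer)

lemma P_nonzero: "norm P > 0" "norm P0 > 0"
proof -
  have "u0 \<noteq> 0" "y0 \<noteq> 0" "u \<noteq> 0" "y \<noteq> 0"
    using base(3) perturbed(4) by auto
  then show "norm P > 0" "norm P0 > 0"
    using base(2) perturbed(3) by (simp_all only: norm_outer) simp_all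
qed

lemma norm_P0_ge_1: "norm P0 \<ge> 1"
  using norm_matrix_mul_le[of P0 P0] P_nonzero idem by simp

text \<open>
  The perturbed eigenvectors nearly lie in the unperturbed eigenspace: \<open>M - \<mu>\<close> annihilates
  \<open>P\<close>, so that \<open>(M0 - \<mu>0) P = - K P\<close>, and \<open>G0\<close> inverts \<open>M0 - \<mu>0\<close> up to \<open>P0\<close>.
\<close>

lemma left_defect: "(mat 1 - P0) ** P = - (G0 ** K ** P)"
proof -
  have "K ** P = - ((M0 - mat \<mu>0) ** P)"
    by (simp add: K_def matrix_mul_diff_left perturbed(1))
  then have "G0 ** K ** P = - (G0 ** (M0 - mat \<mu>0) ** P)"
    by (metis matrix_mul_assoc matrix_mul_minus_right)
  then show ?thesis
    using base by (simp add: spectral_pair_def)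
qed

lemma right_defect: "P ** (mat 1 - P0) = - (P ** K ** G0)"
proof -
  have "P ** K = - (P ** (M0 - mat \<mu>0))"
    by (simp add: K_def matrix_mul_diff_right perturbed(2) mat_mul_commute)
  then have "P ** K ** G0 = - (P ** ((M0 - mat \<mu>0) ** G0))"
    by (metis matrix_mul_assoc matrix_mul_minus_left)
  then show ?thesis
    using base by (simp add: spectral_pair_def)
qed

lemma norm_left_defect: "norm ((mat 1 - P0) ** P) \<le> \<delta> * norm P"
proof -
  have "G0 ** K ** P = G0 ** H ** P - mat m ** (G0 ** P)"
    by (simp add: K_eq matrix_ring_simps mat_mul_commute[of m G0])
  then have "norm ((mat 1 - P0) ** P) \<le> norm (G0 ** H ** P) + norm (mat m ** (G0 ** P))"
    using norm_triangle_ineq4 by (metis left_defect norm_minus_cancel)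
  also have "\<dots> \<le> norm G0 * norm H * norm P + cmod m * (norm G0 * norm P)"
    unfolding norm_mat_mul
    by (intro add_mono mult_left_mono norm_matrix_mul_le norm_matrix_mul_le3) auto
  finally show ?thesis
    by (simp add: \<delta>_def algebra_simps)
qed

lemma norm_right_defect: "norm (P ** (mat 1 - P0)) \<le> \<delta> * norm P"
proof -
  have "P ** K ** G0 = P ** H ** G0 - mat m ** (P ** G0)"
    by (simp add: K_eq matrix_ring_simps mat_mul_commute[of m P])
  then have "norm (P ** (mat 1 - P0)) \<le> norm (P ** H ** G0) + norm (mat m ** (P ** G0))"
    using norm_triangle_ineq4 by (metis right_defect norm_minus_cancel)
  also have "\<dots> \<le> norm P * norm H * norm G0 + cmod m * (norm P * norm G0)"
    unfolding norm_mat_mul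
    by (intro add_mono mult_left_mono norm_matrix_mul_le norm_matrix_mul_le3) auto
  finally show ?thesis
    by (simp add: \<delta>_def algebra_simps)
qed

lemma sandwich: "P0 ** P ** P0 = mat \<tau> ** P0" "P ** P0 ** P = mat \<tau> ** P"
  unfolding base(2) perturbed(3) outer_sandwich \<tau>_def by (simp_all add: mult.commute)

text \<open>
  Expand \<open>P\<close> in blocks relative to \<open>P0\<close>; rank one makes the diagonal block a multiple of
  \<open>P0\<close>.
\<close>

lemma projection_split:
  "P - P0 = mat (\<tau> - 1) ** P0 + (mat 1 - P0) ** P + P0 ** (P ** (mat 1 - P0))"
  using sandwich(1) by (simp add: mat_diff[symmetric] matrix_ring_simps)

text \<open>
  The number \<open>\<tau>\<close>, the trace of \<open>P0 P\<close>, is \<open>1\<close> up to second order, since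
  \<open>(1 - \<tau>) P = P (1 - P0) P\<close> is the product of both defects.
\<close>

lemma one_minus_tau: "cmod (1 - \<tau>) \<le> \<delta>\<^sup>2 * norm P"
proof -
  have "mat (1 - \<tau>) ** P = (P ** (mat 1 - P0)) ** ((mat 1 - P0) ** P)"
    using sandwich(2) by (simp add: mat_diff[symmetric] matrix_ring_simps idem)
      (simp add: idem matrix_mul_assoc[symmetric])
  then have "cmod (1 - \<tau>) * norm P \<le> norm (P ** (mat 1 - P0)) * norm ((mat 1 - P0) ** P)"
    by (metis norm_mat_mul norm_matrix_mul_le)
  also have "\<dots> \<le> (\<delta> * norm P) * (\<delta> * norm P)"
    by (intro mult_mono' norm_left_defect norm_right_defect) auto
  also have "\<dots> = (\<delta>\<^sup>2 * norm P) * norm P"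
    by (simp add: power2_eq_square)
  finally show ?thesis
    using P_nonzero by simp
qed

lemma delta_nonneg: "\<delta> \<ge> 0"
  by (simp add: \<delta>_def)

text \<open>
  Both sides are \<open>P0 (M - M0) P\<close>; this makes the shift of the eigenvalue of the order of \<open>H\<close>.
\<close>

lemma eigenvalue_shift: "mat m ** (P0 ** P) = P0 ** H ** P"
proof -
  have "P0 ** M ** P = mat \<mu> ** (P0 ** P)" "P0 ** M0 ** P = mat \<mu>0 ** (P0 ** P)"
    using base(1) perturbed(1)
    by (metis matrix_mul_assoc mat_mul_commute, metis spectral_pair_def matrix_mul_assoc)
  then show ?thesis
    by (simp add: H_def m_def mat_diff[symmetric] matrix_mul_diff_left matrix_mul_diff_right)
qed

text \<open>
  The identity \<open>D + D\<^sup>2 = (1 - P0) P + P (1 - P0)\<close> for the difference \<open>D = P - P0\<close> of two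
  idempotents expresses \<open>D\<close> through the defects, which are linear in \<open>K\<close>.  Writing
  \<open>P = P0 + D\<close> there isolates the linear term; the shift of the eigenvalue drops out of it
  because \<open>G0 P0 = P0 G0 = 0\<close>.
\<close>

lemma remainder_eq:
  "P - P0 + (G0 ** H ** P0 + P0 ** H ** G0)
    = mat m ** (G0 ** (P - P0) + (P - P0) ** G0)
      - ((P - P0) ** (P - P0) + G0 ** H ** (P - P0) + (P - P0) ** H ** G0)"
proof -
  have "(P - P0) + (P - P0) ** (P - P0) = (mat 1 - P0) ** P + P ** (mat 1 - P0)"
    by (simp add: matrix_ring_simps idem)
  also have "\<dots> = - (G0 ** K ** P) - P ** K ** G0"
    by (simp add: left_defect right_defect)
  also have "G0 ** K ** P = G0 ** H ** P0 + G0 ** H ** (P - P0) - mat m ** (G0 ** (P - P0))"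
  proof -
    have "G0 ** K ** P = G0 ** H ** P - mat m ** (G0 ** P)"
      by (simp add: K_eq matrix_ring_simps mat_mul_commute[of m G0])
    then show ?thesis
      by (simp add: matrix_mul_diff_right G0_P0 matrix_mul_zero_right)
  qed
  also have "P ** K ** G0 = P0 ** H ** G0 + (P - P0) ** H ** G0 - mat m ** ((P - P0) ** G0)"
  proof -
    have "P ** K ** G0 = P ** H ** G0 - mat m ** (P ** G0)"
      by (simp add: K_eq matrix_ring_simps mat_mul_commute[of m P])
    then show ?thesis
      by (simp add: matrix_mul_diff_left matrix_mul_diff_right G0_P0 matrix_mul_zero_right)
  qed
  finally show ?thesis
    by (simp add: matrix_add_ldistrib algebra_simps)
qed

text \<open>
  Below this threshold the defects are too small for \<open>P\<close> to be much larger than \<open>P0\<close>, although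
  no bound on \<open>P\<close> is given in advance.
\<close>

context
  assumes small: "\<delta> * (1 + norm P0) \<le> 1 / 2"
begin

lemma delta_le: "\<delta> \<le> 1 / 4"
proof -
  have "\<delta> * 2 \<le> \<delta> * (1 + norm P0)"
    using norm_P0_ge_1 delta_nonneg by (intro mult_left_mono) auto
  then show ?thesis
    using small by simp
qed

text \<open>
  The block expansion gives \<open>norm P \<le> 2 * cmod \<tau> * norm P0\<close>, and inserting this into the
  bound for \<open>1 - \<tau>\<close> confines \<open>\<tau>\<close>.
\<close>

lemma norm_P_le: "norm P \<le> 3 * norm P0"
proof -
  have "norm P \<le> norm (mat \<tau> ** P0) + norm ((mat 1 - P0) ** P) + norm (P0 ** (P ** (mat 1 - P0)))"
  proof -
    have "P = mat \<tau> ** P0 + (mat 1 - P0) ** P + P0 ** (P ** (mat 1 - P0))"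
      using projection_split by (simp add: mat_diff[symmetric] matrix_mul_diff_left)
    then show ?thesis
      by (metis norm_triangle_le order_refl add_mono_thms_linordered_semiring(3) norm_triangle_ineq)
  qed
  also have "\<dots> \<le> cmod \<tau> * norm P0 + \<delta> * norm P + norm P0 * (\<delta> * norm P)"
    unfolding norm_mat_mul
    by (intro add_mono norm_left_defect order_refl order_trans[OF norm_matrix_mul_le]
        mult_left_mono norm_right_defect) auto
  also have "\<dots> = cmod \<tau> * norm P0 + (\<delta> * (1 + norm P0)) * norm P"
    by (simp add: algebra_simps)
  also have "\<dots> \<le> cmod \<tau> * norm P0 + 1 / 2 * norm P"
    by (intro add_mono mult_right_mono small) auto
  finally have P: "norm P \<le> 2 * cmod \<tau> * norm P0"
    by simp
  have "cmod (1 - \<tau>) \<le> \<delta>\<^sup>2 * (2 * cmod \<tau> * norm P0)"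
    using one_minus_tau P by (meson mult_left_mono order_trans zero_le_power2)
  also have "\<dots> = (2 * \<delta> * (\<delta> * norm P0)) * cmod \<tau>"
    by (simp add: power2_eq_square)
  also have "\<dots> \<le> 1 / 4 * cmod \<tau>"
  proof (rule mult_right_mono)
    have "\<delta> * norm P0 \<le> 1 / 2"
      using small delta_nonneg by (simp add: distrib_left)
    then have "2 * \<delta> * (\<delta> * norm P0) \<le> (2 * (1 / 4)) * (1 / 2)"
      using delta_le delta_nonneg by (intro mult_mono) auto
    then show "2 * \<delta> * (\<delta> * norm P0) \<le> 1 / 4"
      by simp
  qed simp
  finally have "cmod \<tau> \<le> 4 / 3"
    using norm_triangle_sub[of \<tau> 1] by (simp add: norm_minus_commute)
  then have "2 * cmod \<tau> * norm P0 \<le> 3 * norm P0"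
    by (intro mult_right_mono) auto
  with P show ?thesis
    by simp
qed

lemma norm_shift_le: "cmod m \<le> 2 * norm P0 * norm H"
proof -
  have "norm P \<le> norm (P0 ** P) + norm ((mat 1 - P0) ** P)"
    using norm_triangle_ineq[of "P0 ** P" "(mat 1 - P0) ** P"] by (simp add: matrix_mul_diff_left)
  moreover have "\<delta> * norm P \<le> 1 / 4 * norm P"
    using delta_le by (intro mult_right_mono) auto
  ultimately have "3 / 4 * norm P \<le> norm (P0 ** P)"
    using norm_left_defect by simp
  then have "cmod m * (3 / 4 * norm P) \<le> cmod m * norm (P0 ** P)"
    by (intro mult_left_mono) auto
  also have "\<dots> = norm (P0 ** H ** P)"
    by (metis eigenvalue_shift norm_mat_mul)
  also have "\<dots> \<le> norm P0 * norm H * norm P"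
    by (rule norm_matrix_mul_le3)
  finally have "cmod m * (3 / 4) \<le> norm P0 * norm H"
    using P_nonzero by simp
  moreover have "0 \<le> norm P0 * norm H"
    by simp
  ultimately show ?thesis
    by linarith
qed

abbreviation "L \<equiv> projection_lipschitz (norm P0) (norm G0)"

lemma norm_P_diff_le: "norm (P - P0) \<le> L * norm H"
proof -
  have "norm (P - P0) \<le> cmod (1 - \<tau>) * norm P0 + \<delta> * norm P + norm P0 * (\<delta> * norm P)"
  proof -
    have "norm (P - P0) \<le> norm (mat (\<tau> - 1) ** P0) + norm ((mat 1 - P0) ** P)
        + norm (P0 ** (P ** (mat 1 - P0)))"
      unfolding projection_split
      by (meson norm_triangle_le order_refl add_mono norm_triangle_ineq)
    also have "\<dots> \<le> cmod (1 - \<tau>) * norm P0 + \<delta> * norm P + norm P0 * (\<delta> * norm P)"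
      unfolding norm_mat_mul norm_minus_commute[of \<tau> 1]
      by (intro add_mono norm_left_defect order_refl order_trans[OF norm_matrix_mul_le]
          mult_left_mono norm_right_defect) auto
    finally show ?thesis .
  qed
  also have "\<dots> = cmod (1 - \<tau>) * norm P0 + (\<delta> * (1 + norm P0)) * norm P"
    by (simp add: algebra_simps)
  also have "\<dots> \<le> (\<delta>\<^sup>2 * (3 * norm P0)) * norm P0 + (\<delta> * (2 * norm P0)) * (3 * norm P0)"
    using norm_P0_ge_1 delta_nonneg
    by (intro add_mono mult_mono norm_P_le mult_left_mono mult_right_mono
        order_trans[OF one_minus_tau]) auto
  also have "\<dots> = (3 * \<delta> + 6) * ((norm P0)\<^sup>2 * \<delta>)"
    by (simp add: power2_eq_square algebra_simps)
  also have "\<dots> \<le> 7 * ((norm P0)\<^sup>2 * \<delta>)"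
    using delta_le delta_nonneg by (intro mult_right_mono) auto
  also have "\<dots> \<le> 7 * ((norm P0)\<^sup>2 * (norm G0 * (norm H + 2 * norm P0 * norm H)))"
    unfolding \<delta>_def by (intro mult_left_mono add_mono norm_shift_le) auto
  finally show ?thesis
    by (simp add: projection_lipschitz_def algebra_simps)
qed

lemma norm_remainder_le:
  "norm (P - P0 + (G0 ** H ** P0 + P0 ** H ** G0))
    \<le> (4 * norm P0 * norm G0 * L + L\<^sup>2 + 2 * norm G0 * L) * (norm H)\<^sup>2"
proof -
  let ?D = "P - P0" and ?g = "norm G0" and ?h = "norm H"
  have L: "L \<ge> 0"
    by (simp add: projection_lipschitz_def)
  have Dh: "norm ?D \<le> L * ?h"
    by (rule norm_P_diff_le)
  have "norm (P - P0 + (G0 ** H ** P0 + P0 ** H ** G0))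
      \<le> norm (mat m ** (G0 ** ?D + ?D ** G0))
        + (norm (?D ** ?D) + norm (G0 ** H ** ?D) + norm (?D ** H ** G0))"
    unfolding remainder_eq
    by (intro order_trans[OF norm_triangle_ineq4] add_mono norm_triangle_mono order_refl)
  also have "norm (mat m ** (G0 ** ?D + ?D ** G0)) \<le> (2 * norm P0 * ?h) * (?g * (L * ?h) + (L * ?h) * ?g)"
    unfolding norm_mat_mul
    by (intro mult_mono norm_shift_le norm_triangle_mono order_trans[OF norm_matrix_mul_le] Dh)
      (auto simp: L)
  also have "norm (?D ** ?D) \<le> (L * ?h) * (L * ?h)"
    by (intro order_trans[OF norm_matrix_mul_le] mult_mono Dh) (auto simp: L)
  also have "norm (G0 ** H ** ?D) \<le> ?g * ?h * (L * ?h)"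
    by (intro order_trans[OF norm_matrix_mul_le3] mult_left_mono Dh) simp
  also have "norm (?D ** H ** G0) \<le> (L * ?h) * ?h * ?g"
    by (intro order_trans[OF norm_matrix_mul_le3] mult_right_mono Dh) auto
  finally show ?thesis
    by (simp add: power2_eq_square algebra_simps)
qed

end

end

section \<open>Continuation of a simple eigenvalue\<close>

lemma degree_charpoly_le: "degree (charpoly M) \<le> CARD('n)" for M :: "'n::finite cmat"
proof -
  let ?B = "mat [:0, 1:] - (\<chi> i j. [:M $ i $ j:])"
  have entry: "degree (?B $ i $ j) \<le> 1" for i j
  proof -
    have "?B $ i $ j = (if i = j then [:- M $ i $ j, 1:] else [:- M $ i $ j:])"
      by (simp add: mat_def)
    then show ?thesis
      by simp
  qed
  have "degree (of_int (sign p) * (\<Prod>i\<in>UNIV. ?B $ i $ p i)) \<le> CARD('n)" for p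
  proof -
    have "degree (\<Prod>i\<in>UNIV. ?B $ i $ p i) \<le> (\<Sum>i\<in>UNIV. degree (?B $ i $ p i))"
      using degree_prod_sum_le[of UNIV "\<lambda>i. ?B $ i $ p i"] by (simp add: o_def)
    also have "\<dots> \<le> (\<Sum>i\<in>(UNIV :: 'n set). 1)"
      by (intro sum_mono entry)
    also have "\<dots> = CARD('n)"
      by simp
    finally show ?thesis
      using degree_mult_le[of "of_int (sign p)" "\<Prod>i\<in>UNIV. ?B $ i $ p i"]
      by (simp del: vector_minus_component)
  qed
  then show ?thesis
    unfolding charpoly_def det_def by (intro degree_sum_le) (auto simp: finite_permutations)
qed

lemma continuous_coeff_prod:
  fixes g :: "'a::topological_space \<Rightarrow> 'b \<Rightarrow> complex poly"
  assumes "\<And>i k. continuous_on UNIV (\<lambda>M. coeff (g M i) k)"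
  shows "continuous_on UNIV (\<lambda>M. coeff (\<Prod>i\<in>A. g M i) k)"
proof (induction A arbitrary: k rule: infinite_finite_induct)
  case (insert i A)
  then show ?case
    by (simp add: coeff_mult) (intro continuous_intros assms insert.IH)
qed simp_all

lemma continuous_coeff_charpoly:
  "continuous_on UNIV (\<lambda>M :: 'n::finite cmat. coeff (charpoly M) k)"
proof -
  have "continuous_on UNIV (\<lambda>M :: 'n cmat. coeff ((mat [:0, 1:] - (\<chi> i j. [:M $ i $ j:])) $ i $ j) k)"
    for i j k
    by (cases k) (auto intro!: continuous_intros simp: coeff_pCons)
  then have "continuous_on UNIV (\<lambda>M :: 'n cmat.
      coeff (\<Prod>i\<in>UNIV. (mat [:0, 1:] - (\<chi> i j. [:M $ i $ j:])) $ i $ p i) k)" for p k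
    by (rule continuous_coeff_prod)
  then show ?thesis
    unfolding charpoly_def det_def coeff_sum of_int_poly
    by (simp del: vector_minus_component) (intro continuous_intros)
qed

lemma poly_eq_sum_upto:
  fixes p :: "complex poly"
  assumes "degree p \<le> n"
  shows "poly p z = (\<Sum>i\<le>n. coeff p i * z ^ i)"
proof -
  have "(\<Sum>i\<le>degree p. coeff p i * z ^ i) = (\<Sum>i\<le>n. coeff p i * z ^ i)"
    using assms by (intro sum.mono_neutral_left) (auto simp: coeff_eq_0)
  then show ?thesis
    by (simp add: poly_altdef)
qed

lemma isCont_tendsto_nhds: "isCont f a \<Longrightarrow> (f \<longlongrightarrow> f a) (nhds a)"
  by (simp add: isCont_def tendsto_at_iff_tendsto_nhds)

text \<open>
  Joint continuity in the matrix and the point, since the number of coefficients is bounded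
  uniformly in the matrix.
\<close>

lemma tendsto_charpoly:
  fixes M0 :: "'n::finite cmat"
  shows "((\<lambda>(M, z). poly (charpoly M) z) \<longlongrightarrow> poly (charpoly M0) z0) (nhds (M0, z0))"
    and "((\<lambda>(M, z). poly (pderiv (charpoly M)) z) \<longlongrightarrow> poly (pderiv (charpoly M0)) z0)
          (nhds (M0, z0))"
proof -
  have coeff: "isCont (\<lambda>q :: 'n cmat \<times> complex. coeff (charpoly (fst q)) k) (M0, z0)" for k
    using continuous_coeff_charpoly[where 'n = 'n and k = k]
    by (intro isCont_o2[OF isCont_fst[OF continuous_ident]])
       (simp add: continuous_on_eq_continuous_at)
  have "isCont (\<lambda>q. poly (charpoly (fst q)) (snd q)) (M0, z0)"
    unfolding poly_eq_sum_upto[OF degree_charpoly_le] by (intro continuous_intros coeff)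
  then show "((\<lambda>(M, z). poly (charpoly M) z) \<longlongrightarrow> poly (charpoly M0) z0) (nhds (M0, z0))"
    using isCont_tendsto_nhds by (force simp: case_prod_beta')
  have "degree (pderiv (charpoly M)) \<le> CARD('n)" for M :: "'n cmat"
    using degree_charpoly_le[of M] by (simp add: degree_pderiv)
  note * = poly_eq_sum_upto[OF this]
  have "isCont (\<lambda>q. poly (pderiv (charpoly (fst q))) (snd q)) (M0, z0)"
    unfolding * coeff_pderiv by (intro continuous_intros coeff)
  then show "((\<lambda>(M, z). poly (pderiv (charpoly M)) z) \<longlongrightarrow> poly (pderiv (charpoly M0)) z0)
          (nhds (M0, z0))"
    using isCont_tendsto_nhds by (force simp: case_prod_beta')
qed

text \<open>
  The logarithmic derivative \<open>p'/p = \<Sum> 1 / (z - r)\<close>, the sum running over the roots \<open>r\<close> with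
  multiplicity, is at most \<open>degree p / e\<close> at distance \<open>e\<close> from all the roots.
\<close>

lemma pderiv_bound_away_from_roots:
  fixes p :: "complex poly"
  assumes "e > 0" "\<And>w. poly p w = 0 \<Longrightarrow> e \<le> cmod (z - w)"
  shows "e * cmod (poly (pderiv p) z) \<le> real (degree p) * cmod (poly p z)"
  using assms(2)
proof (induction "degree p" arbitrary: p)
  case 0
  then obtain c where "p = [:c:]"
    by (metis degree_eq_zeroE)
  then show ?case
    by simp
next
  case (Suc n)
  then have "\<not> constant (poly p)"
    by (simp add: constant_degree)
  then obtain r where r: "poly p r = 0"
    using fundamental_theorem_of_algebra by blast
  then obtain q where q: "p = [:- r, 1:] * q"
    by (auto simp: poly_eq_0_iff_dvd)
  have "q \<noteq> 0"
    using q Suc.hyps by auto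
  then have deg: "degree p = Suc (degree q)"
    unfolding q by (subst degree_mult_eq) auto
  then have IH: "e * cmod (poly (pderiv q) z) \<le> real (degree q) * cmod (poly q z)"
    using Suc.hyps Suc.prems q by auto
  have e: "e \<le> cmod (z - r)"
    using Suc.prems r .
  have "poly (pderiv p) z = poly q z + (z - r) * poly (pderiv q) z"
    unfolding q pderiv_mult by (simp add: pderiv_pCons algebra_simps)
  then have "e * cmod (poly (pderiv p) z)
      \<le> e * (cmod (poly q z) + cmod (z - r) * cmod (poly (pderiv q) z))"
    using \<open>e > 0\<close> by (simp add: norm_triangle_le norm_mult)
  also have "\<dots> = e * cmod (poly q z) + cmod (z - r) * (e * cmod (poly (pderiv q) z))"
    by (simp add: algebra_simps)
  also have "\<dots> \<le> cmod (z - r) * cmod (poly q z)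
      + cmod (z - r) * (real (degree q) * cmod (poly q z))"
    by (intro add_mono mult_right_mono mult_left_mono IH e) auto
  also have "\<dots> = real (degree p) * (cmod (z - r) * cmod (poly q z))"
    by (simp add: deg algebra_simps)
  also have "cmod (z - r) * cmod (poly q z) = cmod (poly p z)"
    by (simp add: q norm_mult[symmetric] algebra_simps)
  finally show ?case .
qed

text \<open>
  As \<open>M\<close> tends to \<open>M0\<close>, the values of \<open>p\<close> at \<open>z0\<close> tend to zero while those of \<open>p'\<close> do not,
  which is impossible if all the roots keep a fixed distance from \<open>z0\<close>.
\<close>

lemma eigenvalue_near_simple_eigenvalue:
  fixes M0 :: "'n::finite cmat"
  assumes simple: "simple_eigenvalue M0 z0" and "e > 0"
  shows "\<forall>\<^sub>F M in nhds M0. \<exists>z\<in>ball z0 e. det (mat z - M) = 0"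
proof -
  have lim: "filterlim (\<lambda>M. (M, z0)) (nhds (M0, z0)) (nhds M0)"
    by (simp add: nhds_prod filterlim_Pair filterlim_ident)
  have "((\<lambda>M. e * cmod (poly (pderiv (charpoly M)) z0) - real CARD('n) * cmod (poly (charpoly M) z0))
      \<longlongrightarrow> e * cmod (poly (pderiv (charpoly M0)) z0) - real CARD('n) * cmod (poly (charpoly M0) z0))
      (nhds M0)"
    using filterlim_compose[OF tendsto_charpoly(1) lim] filterlim_compose[OF tendsto_charpoly(2) lim]
    by (intro tendsto_intros) simp_all
  moreover have "0 < e * cmod (poly (pderiv (charpoly M0)) z0)
      - real CARD('n) * cmod (poly (charpoly M0) z0)"
    using simple \<open>e > 0\<close> by (simp add: simple_eigenvalue_iff poly_charpoly)
  ultimately have "\<forall>\<^sub>F M in nhds M0.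
      0 < e * cmod (poly (pderiv (charpoly M)) z0) - real CARD('n) * cmod (poly (charpoly M) z0)"
    by (rule order_tendstoD)
  then show ?thesis
  proof eventually_elim
    case (elim M)
    have "real (degree (charpoly M)) * cmod (poly (charpoly M) z0)
        \<le> real CARD('n) * cmod (poly (charpoly M) z0)"
      by (intro mult_right_mono) (simp_all add: degree_charpoly_le)
    with elim have "\<not> e * cmod (poly (pderiv (charpoly M)) z0)
        \<le> real (degree (charpoly M)) * cmod (poly (charpoly M) z0)"
      by simp
    then obtain w where "poly (charpoly M) w = 0" "\<not> e \<le> cmod (z0 - w)"
      using pderiv_bound_away_from_roots[OF \<open>e > 0\<close>] by blast
    then show ?case
      by (auto simp: poly_charpoly dist_norm intro!: bexI[of _ w])
  qed
qed

text \<open>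
  Where \<open>p'\<close> stays close to the nonzero number \<open>p'(\<mu>)\<close>, the polynomial \<open>p\<close> is close to an
  injective linear function.
\<close>

lemma charpoly_locally_injective:
  fixes M0 :: "'n::finite cmat"
  assumes simple: "simple_eigenvalue M0 \<mu>"
  obtains r where "r > 0" "\<forall>\<^sub>F M in nhds M0. inj_on (poly (charpoly M)) (ball \<mu> r) \<and>
      (\<forall>z\<in>ball \<mu> r. poly (pderiv (charpoly M)) z \<noteq> 0)"
proof -
  define d where "d = poly (pderiv (charpoly M0)) \<mu>"
  have "d \<noteq> 0"
    using simple by (simp add: d_def simple_eigenvalue_iff)
  then have "\<forall>\<^sub>F q in nhds (M0, \<mu>).
      dist ((\<lambda>(M, z). poly (pderiv (charpoly M)) z) q) d < cmod d / 2"
    using tendsto_charpoly(2)[of M0 \<mu>] unfolding d_def by (intro tendstoD) auto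
  then obtain Q R where QR: "eventually Q (nhds M0)" "eventually R (nhds \<mu>)"
    "\<And>M z. Q M \<Longrightarrow> R z \<Longrightarrow> dist (poly (pderiv (charpoly M)) z) d < cmod d / 2"
    by (auto simp: nhds_prod eventually_prod_filter)
  from QR(2) obtain r where r: "r > 0" "\<And>z. dist z \<mu> < r \<Longrightarrow> R z"
    by (auto simp: eventually_nhds_metric)
  have close: "cmod (poly (pderiv (charpoly M)) z - d) < cmod d / 2" if "Q M" "z \<in> ball \<mu> r" for M z
    using QR(3)[OF that(1) r(2)] that(2) by (simp add: dist_norm norm_minus_commute)
  have "inj_on (poly (charpoly M)) (ball \<mu> r)" if "Q M" for M
  proof (rule inj_onI)
    fix a b
    assume ab: "a \<in> ball \<mu> r" "b \<in> ball \<mu> r" "poly (charpoly M) a = poly (charpoly M) b"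
    have "cmod ((poly (charpoly M) a - d * a) - (poly (charpoly M) b - d * b)) \<le> cmod d / 2 * cmod (a - b)"
    proof (rule field_differentiable_bound[of "ball \<mu> r" _ "\<lambda>z. poly (pderiv (charpoly M)) z - d"])
      show "((\<lambda>z. poly (charpoly M) z - d * z) has_field_derivative poly (pderiv (charpoly M)) z - d)
          (at z within ball \<mu> r)" for z
        by (auto intro!: derivative_eq_intros)
      show "cmod (poly (pderiv (charpoly M)) z - d) \<le> cmod d / 2" if "z \<in> ball \<mu> r" for z
        using close[OF \<open>Q M\<close> that] by simp
    qed (use ab in auto)
    moreover have "(poly (charpoly M) a - d * a) - (poly (charpoly M) b - d * b) = d * (b - a)"
      using ab by (simp add: algebra_simps)
    ultimately have "cmod d * cmod (a - b) \<le> cmod d / 2 * cmod (a - b)"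
      by (simp add: norm_mult norm_minus_commute)
    then show "a = b"
      using \<open>d \<noteq> 0\<close> by (simp add: field_simps)
  qed
  moreover have "poly (pderiv (charpoly M)) z \<noteq> 0" if "Q M" "z \<in> ball \<mu> r" for M z
    using close[OF that] by auto
  ultimately show thesis
    using r(1) QR(1) by (intro that[of r]) (auto elim!: eventually_mono)
qed

text \<open>
  Near \<open>M0\<close> there is exactly one eigenvalue near \<open>\<mu>\<close>, and it is simple.  Existence near the
  simple eigenvalue \<open>\<Lambda> M1\<close> of another matrix \<open>M1\<close>, combined with this uniqueness, gives
  continuity of the branch at \<open>M1\<close>.
\<close>

lemma simple_eigenvalue_branch:
  fixes M0 :: "'n::finite cmat"
  assumes simple: "simple_eigenvalue M0 \<mu>"
  obtains W r \<Lambda> where "open W" "M0 \<in> W" "r > 0" "continuous_on W \<Lambda>"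
    "\<And>M. M \<in> W \<Longrightarrow> simple_eigenvalue M (\<Lambda> M)"
    "\<And>M z. M \<in> W \<Longrightarrow> z \<in> ball \<mu> r \<Longrightarrow> det (mat z - M) = 0 \<Longrightarrow> z = \<Lambda> M"
proof -
  obtain r where "r > 0" and r: "\<forall>\<^sub>F M in nhds M0. inj_on (poly (charpoly M)) (ball \<mu> r) \<and>
      (\<forall>z\<in>ball \<mu> r. poly (pderiv (charpoly M)) z \<noteq> 0)"
    by (rule charpoly_locally_injective[OF simple])
  from eigenvalue_near_simple_eigenvalue[OF simple \<open>r > 0\<close>] r
  have "\<forall>\<^sub>F M in nhds M0. (\<exists>z\<in>ball \<mu> r. det (mat z - M) = 0) \<and>
      inj_on (poly (charpoly M)) (ball \<mu> r) \<and> (\<forall>z\<in>ball \<mu> r. poly (pderiv (charpoly M)) z \<noteq> 0)"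
    by (rule eventually_conj)
  then obtain W where W: "open W" "M0 \<in> W"
    and ex: "\<And>M. M \<in> W \<Longrightarrow> \<exists>z\<in>ball \<mu> r. det (mat z - M) = 0"
    and inj: "\<And>M. M \<in> W \<Longrightarrow> inj_on (poly (charpoly M)) (ball \<mu> r)"
    and nz: "\<And>M z. M \<in> W \<Longrightarrow> z \<in> ball \<mu> r \<Longrightarrow> poly (pderiv (charpoly M)) z \<noteq> 0"
    unfolding eventually_nhds by blast
  from ex obtain \<Lambda> where \<Lambda>: "\<And>M. M \<in> W \<Longrightarrow> \<Lambda> M \<in> ball \<mu> r \<and> det (mat (\<Lambda> M) - M) = 0"
    by metis
  have simple': "simple_eigenvalue M (\<Lambda> M)" if "M \<in> W" for M
    using \<Lambda>[OF that] nz[OF that] by (simp add: simple_eigenvalue_iff)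
  have unique: "z = \<Lambda> M" if "M \<in> W" "z \<in> ball \<mu> r" "det (mat z - M) = 0" for M z
    using inj_onD[OF inj[OF that(1)], of z "\<Lambda> M"] \<Lambda>[OF that(1)] that by (simp add: poly_charpoly)
  have "(\<Lambda> \<longlongrightarrow> \<Lambda> M1) (at M1)" if "M1 \<in> W" for M1
    unfolding tendsto_at_iff_tendsto_nhds
  proof (rule tendstoI)
    fix e :: real
    assume "e > 0"
    \<comment> \<open>Within this smaller ball, a nearby eigenvalue is still the unique one in the ball around
      \<open>\<mu>\<close>.\<close>
    obtain s where "s > 0" and s: "ball (\<Lambda> M1) s \<subseteq> ball \<mu> r"
      using \<Lambda>[OF \<open>M1 \<in> W\<close>] by (meson open_ball open_contains_ball)
    have "\<forall>\<^sub>F M in nhds M1. \<exists>z\<in>ball (\<Lambda> M1) (min e s). det (mat z - M) = 0"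
      using \<open>e > 0\<close> \<open>s > 0\<close> by (intro eigenvalue_near_simple_eigenvalue simple' that) auto
    moreover have "\<forall>\<^sub>F M in nhds M1. M \<in> W"
      using W that by (intro eventually_nhds_in_open)
    ultimately show "\<forall>\<^sub>F M in nhds M1. dist (\<Lambda> M) (\<Lambda> M1) < e"
    proof eventually_elim
      case (elim M)
      then obtain z where z: "z \<in> ball (\<Lambda> M1) (min e s)" "det (mat z - M) = 0"
        by blast
      then have "z = \<Lambda> M"
        using s elim by (intro unique) auto
      then show ?case
        using z by (simp add: dist_commute)
    qed
  qed
  then have "continuous_on W \<Lambda>"
    using W by (simp add: continuous_on_eq_continuous_at isCont_def)
  with W \<open>r > 0\<close> simple' unique show thesis
    by (intro that)
qed

text \<open>
  Near \<open>E\<close>, the continuous function \<open>lam\<close> takes values close to \<open>lam E\<close>, where only one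
  eigenvalue of the perturbed matrix is available.
\<close>

lemma ambient_continuation_exists:
  fixes A :: "'n::finite cmat"
  assumes "continuous_on unit_sphere lam" "E \<in> unit_sphere"
    and simple: "\<And>F. F \<in> unit_sphere \<Longrightarrow> simple_eigenvalue (A + \<epsilon> *\<^sub>R F) (lam F)"
  shows "\<exists>U \<Lambda>. ambient_continuation A \<epsilon> lam E U \<Lambda>"
proof -
  obtain W r \<Lambda> where W: "open W" "A + \<epsilon> *\<^sub>R E \<in> W" "r > 0" "continuous_on W \<Lambda>"
    "\<And>M. M \<in> W \<Longrightarrow> simple_eigenvalue M (\<Lambda> M)"
    "\<And>M z. M \<in> W \<Longrightarrow> z \<in> ball (lam E) r \<Longrightarrow> det (mat z - M) = 0 \<Longrightarrow> z = \<Lambda> M"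
    by (rule simple_eigenvalue_branch[OF simple[OF \<open>E \<in> unit_sphere\<close>]]) (rule that)
  obtain V where V: "open V" "V \<inter> unit_sphere = lam -` ball (lam E) r \<inter> unit_sphere"
    using assms(1) unfolding continuous_on_open_invariant by (metis open_ball)
  define shift where "shift F = A + \<epsilon> *\<^sub>R F" for F
  have shift: "continuous_on S shift" for S
    unfolding shift_def by (intro continuous_intros)
  define U where "U = shift -` W \<inter> V"
  have "open U"
    unfolding U_def using W V shift[of UNIV] by (intro open_Int open_vimage)
  moreover have "E \<in> V"
    using V(2) assms(2) \<open>r > 0\<close> by auto
  then have "E \<in> U"
    using W by (simp add: U_def shift_def)
  moreover have "continuous_on U (\<Lambda> \<circ> shift)"
    using W(4) by (intro continuous_on_compose shift) (auto simp: U_def elim: continuous_on_subset)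
  moreover have "lam F = \<Lambda> (shift F)" if "F \<in> U" "F \<in> unit_sphere" for F
    using that V(2) simple[OF that(2)]
    by (intro W(6)) (auto simp: U_def shift_def simple_eigenvalue_iff)
  ultimately have "ambient_continuation A \<epsilon> lam E U (\<Lambda> \<circ> shift)"
    unfolding ambient_continuation_def using W(5) by (auto simp: U_def shift_def)
  then show ?thesis
    by blast
qed

section \<open>The gradient of the overlap\<close>

lemma mat_of_real_mul: "mat (complex_of_real c) ** A = c *\<^sub>R (A :: 'n::finite cmat)"
  by (simp add: vec_eq_iff mat_mul scaleR_conv_of_real[where 'a = complex])

lemma outer_scale_scale: "outer (c *s x) (c *s x) = (cmod c)\<^sup>2 *\<^sub>R outer x x"
proof -
  have "c * x $ i * (cnj c * cnj (x $ j)) = (c * cnj c) * (x $ i * cnj (x $ j))" for i j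
    by simp
  then show ?thesis
    by (simp add: vec_eq_iff scaleR_conv_of_real[where 'a = complex] complex_norm_square[symmetric])
qed

lemma simple_eigenpair_cinner_nonzero:
  assumes "simple_eigenvalue M \<mu>" "right_eigenvector M \<mu> x" "left_eigenvector M \<mu> y"
  shows "cinner y x \<noteq> 0"
  using assms simple_eigenvalue_cinner_nonzero by (auto simp: right_eigenvector_def left_eigenvector_iff)

lemma norm_eigenprojection:
  assumes "norm x = 1" "norm y = 1"
  shows "norm (eigenprojection x y) = inverse (cmod (cinner y x))"
  using assms by (simp add: eigenprojection_def norm_outer norm_vec_scale norm_inverse)

lemma eigenprojection_mul_ctranspose:
  assumes "norm x = 1" "norm y = 1"
  defines "P \<equiv> eigenprojection x y"
  shows "P ** ctranspose P = (inverse (cmod (cinner y x)))\<^sup>2 *\<^sub>R outer x x"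
    and "ctranspose P ** P = (inverse (cmod (cinner y x)))\<^sup>2 *\<^sub>R outer y y"
proof -
  show "P ** ctranspose P = (inverse (cmod (cinner y x)))\<^sup>2 *\<^sub>R outer x x"
    using assms by (simp add: eigenprojection_def ctranspose_outer outer_mul_outer cinner_self
        outer_scale_scale norm_inverse)
  have "cinner (inverse (cinner y x) *s x) (inverse (cinner y x) *s x)
      = complex_of_real ((inverse (cmod (cinner y x)))\<^sup>2)"
    using assms by (simp only: cinner_self norm_vec_scale norm_inverse) simp
  then show "ctranspose P ** P = (inverse (cmod (cinner y x)))\<^sup>2 *\<^sub>R outer y y"
    by (simp only: P_def eigenprojection_def ctranspose_outer outer_mul_outer mat_of_real_mul)
qed

lemma bounded_linear_projection_derivative:
  fixes G P :: "'n::finite cmat"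
  shows "bounded_linear (\<lambda>Z. - (\<epsilon> *\<^sub>R (G ** Z ** P + P ** Z ** G)))"
proof -
  have "linear (\<lambda>Z. - (\<epsilon> *\<^sub>R (G ** Z ** P + P ** Z ** G)))"
    by (rule linearI)
       (simp_all add: matrix_add_ldistrib matrix_mul_add_left matrix_mul_scaleR_left
         matrix_mul_scaleR_right algebra_simps)
  then show ?thesis
    by (simp add: linear_conv_bounded_linear)
qed

text \<open>
  Once \<open>F\<close> is so close to \<open>E\<close> that the perturbation estimates apply, the remainder is quadratic in
  \<open>F - E\<close>.  The chosen eigenvectors may jump by unimodular factors, but these cancel in the
  projection.
\<close>

lemma eigenprojection_has_derivative:
  fixes A :: "'n::finite cmat"
  assumes U: "open U" "E \<in> U" "continuous_on U \<Lambda>"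
    and simple: "\<And>F. F \<in> U \<Longrightarrow> simple_eigenvalue (A + \<epsilon> *\<^sub>R F) (\<Lambda> F)"
    and x: "\<And>F. F \<in> U \<Longrightarrow> right_eigenvector (A + \<epsilon> *\<^sub>R F) (\<Lambda> F) (x F)"
    and y: "\<And>F. F \<in> U \<Longrightarrow> left_eigenvector (A + \<epsilon> *\<^sub>R F) (\<Lambda> F) (y F)"
  defines "P \<equiv> \<lambda>F. eigenprojection (x F) (y F)"
    and "G \<equiv> group_inverse (A + \<epsilon> *\<^sub>R E - mat (\<Lambda> E))"
  shows "(P has_derivative (\<lambda>Z. - (\<epsilon> *\<^sub>R (G ** Z ** P E + P E ** Z ** G)))) (at E)"
proof -
  let ?\<delta> = "\<lambda>F. norm G * (norm (\<epsilon> *\<^sub>R (F - E)) + cmod (\<Lambda> F - \<Lambda> E)) * (1 + norm (P E))"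
  define C where "C = (let L = projection_lipschitz (norm (P E)) (norm G)
    in 4 * norm (P E) * norm G * L + L\<^sup>2 + 2 * norm G * L)"
  have "(\<Lambda> \<longlongrightarrow> \<Lambda> E) (at E)"
    using U by (metis at_within_open continuous_on_def)
  then have "(?\<delta> \<longlongrightarrow> norm G * (norm (\<epsilon> *\<^sub>R (E - E)) + cmod (\<Lambda> E - \<Lambda> E)) * (1 + norm (P E))) (at E)"
    by (intro tendsto_intros)
  then have "\<forall>\<^sub>F F in at E. ?\<delta> F < 1 / 2"
    by (rule order_tendstoD) simp
  moreover have "\<forall>\<^sub>F F in at E. F \<in> U"
    using U by (simp add: eventually_at_topological) blast
  ultimately have "\<forall>\<^sub>F F in at E. ?\<delta> F < 1 / 2 \<and> F \<in> U"
    by (rule eventually_conj)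
  then obtain d where d: "d > 0" "\<And>F. F \<noteq> E \<Longrightarrow> dist F E < d \<Longrightarrow> ?\<delta> F < 1 / 2 \<and> F \<in> U"
    unfolding eventually_at by blast
  show ?thesis
  proof (rule has_derivativeI_sandwich[of d])
    show "d > 0"
      by (rule d)
    show "bounded_linear (\<lambda>Z. - (\<epsilon> *\<^sub>R (G ** Z ** P E + P E ** Z ** G)))"
      by (rule bounded_linear_projection_derivative)
    fix F
    assume F: "F \<noteq> E" "dist F E < d"
    interpret perturbed_eigenprojection "A + \<epsilon> *\<^sub>R E" "A + \<epsilon> *\<^sub>R F" "P E" "P F" G "\<Lambda> E" "\<Lambda> F"
      "inverse (cinner (y E) (x E)) *s x E" "y E" "inverse (cinner (y F) (x F)) *s x F" "y F"
    proof
      show "spectral_pair (A + \<epsilon> *\<^sub>R E) (\<Lambda> E) (P E) G"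
        unfolding P_def G_def by (intro group_inverse_spectral_pair simple x y U)
      have FU: "F \<in> U"
        using d(2)[OF F] by simp
      have "spectral_pair (A + \<epsilon> *\<^sub>R F) (\<Lambda> F) (P F) (group_inverse (A + \<epsilon> *\<^sub>R F - mat (\<Lambda> F)))"
        unfolding P_def by (intro group_inverse_spectral_pair simple x y FU)
      then show "(A + \<epsilon> *\<^sub>R F) ** P F = mat (\<Lambda> F) ** P F" "P F ** (A + \<epsilon> *\<^sub>R F) = mat (\<Lambda> F) ** P F"
        by (simp_all add: spectral_pair_def)
      show "cinner (y E) (inverse (cinner (y E) (x E)) *s x E) = 1"
        using simple_eigenpair_cinner_nonzero[OF simple x y] U by (simp add: cinner_scale_right)
      show "cinner (y F) (inverse (cinner (y F) (x F)) *s x F) = 1"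
        using simple_eigenpair_cinner_nonzero[OF simple x y] FU by (simp add: cinner_scale_right)
    qed (simp_all add: P_def eigenprojection_def)
    have H: "H = \<epsilon> *\<^sub>R (F - E)"
      by (simp add: H_def algebra_simps)
    have "\<delta> * (1 + norm (P E)) \<le> 1 / 2"
      using d(2)[OF F] by (simp add: \<delta>_def H m_def)
    then have "norm (P F - P E + (G ** H ** P E + P E ** H ** G)) \<le> C * (norm H)\<^sup>2"
      using norm_remainder_le by (simp add: C_def Let_def)
    also have "P F - P E + (G ** H ** P E + P E ** H ** G)
        = P F - P E - - (\<epsilon> *\<^sub>R (G ** (F - E) ** P E + P E ** (F - E) ** G))"
      by (simp add: H matrix_mul_scaleR_left matrix_mul_scaleR_right scaleR_add_right)
    also have "C * (norm H)\<^sup>2 = C * \<epsilon>\<^sup>2 * norm (F - E) * norm (F - E)"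
      by (simp add: H power_mult_distrib power2_eq_square)
    finally show "norm (P F - P E - - (\<epsilon> *\<^sub>R (G ** (F - E) ** P E + P E ** (F - E) ** G))) / norm (F - E)
        \<le> C * \<epsilon>\<^sup>2 * norm (F - E)"
      using F by (simp add: divide_le_eq)
  next
    have "((\<lambda>F. C * \<epsilon>\<^sup>2 * norm (F - E)) \<longlongrightarrow> C * \<epsilon>\<^sup>2 * norm (E - E)) (at E)"
      by (intro tendsto_intros)
    then show "((\<lambda>F. C * \<epsilon>\<^sup>2 * norm (F - E)) \<longlongrightarrow> 0) (at E)"
      by simp
  qed
qed

text \<open>
  The overlap is the reciprocal of the norm of the eigenprojection.  Differentiating the norm
  pairs \<open>P\<close> with \<open>G Z P + P Z G\<close>; moving the factors to the other side turns \<open>P P\<^sup>H\<close> and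
  \<open>P\<^sup>H P\<close> into multiples of \<open>x x\<^sup>H\<close> and \<open>y y\<^sup>H\<close>, and \<open>S\<close> appears.
\<close>

lemma gderiv_overlap:
  fixes A :: "'n::finite cmat"
  assumes xy: "eigvec_choice x y" and U: "ambient_continuation A \<epsilon> lam E U \<Lambda>"
  shows "GDERIV (\<lambda>F. overlap x y (A + \<epsilon> *\<^sub>R F) (\<Lambda> F)) E :>
    (\<epsilon> * overlap x y (A + \<epsilon> *\<^sub>R E) (\<Lambda> E)) *\<^sub>R S_matrix x y (A + \<epsilon> *\<^sub>R E) (\<Lambda> E)"
proof -
  define X where "X F = x (A + \<epsilon> *\<^sub>R F) (\<Lambda> F)" for F
  define Y where "Y F = y (A + \<epsilon> *\<^sub>R F) (\<Lambda> F)" for F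
  define P where "P F = eigenprojection (X F) (Y F)" for F
  define G where "G = group_inverse (A + \<epsilon> *\<^sub>R E - mat (\<Lambda> E))"
  define f where "f = overlap x y (A + \<epsilon> *\<^sub>R E) (\<Lambda> E)"
  define S where "S = S_matrix x y (A + \<epsilon> *\<^sub>R E) (\<Lambda> E)"
  have U': "open U" "E \<in> U" "continuous_on U \<Lambda>"
    and simple: "\<And>F. F \<in> U \<Longrightarrow> simple_eigenvalue (A + \<epsilon> *\<^sub>R F) (\<Lambda> F)"
    using U by (auto simp: ambient_continuation_def)
  have XY: "right_eigenvector (A + \<epsilon> *\<^sub>R F) (\<Lambda> F) (X F)" "norm (X F) = 1"
    "left_eigenvector (A + \<epsilon> *\<^sub>R F) (\<Lambda> F) (Y F)" "norm (Y F) = 1" if "F \<in> U" for F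
    using xy simple[OF that] by (simp_all add: eigvec_choice_def X_def Y_def)
  have P: "(P has_derivative (\<lambda>Z. - (\<epsilon> *\<^sub>R (G ** Z ** P E + P E ** Z ** G)))) (at E)"
    unfolding P_def G_def
    by (rule eigenprojection_has_derivative[OF U' simple XY(1) XY(3)])
  have overlap: "overlap x y (A + \<epsilon> *\<^sub>R F) (\<Lambda> F) = inverse (norm (P F))" if "F \<in> U" for F
    using XY[OF that] by (simp add: P_def norm_eigenprojection overlap_def X_def Y_def)
  have f: "f > 0" "norm (P E) = inverse f"
    using overlap[OF \<open>E \<in> U\<close>] simple_eigenpair_cinner_nonzero[OF simple XY(1) XY(3)] U'
    by (auto simp: f_def overlap_def X_def Y_def)
  then have "P E \<noteq> 0"
    by auto
  have "((\<lambda>F. inverse (norm (P F))) has_derivative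
      (\<lambda>Z. - (inverse (norm (P E))
        * inner (- (\<epsilon> *\<^sub>R (G ** Z ** P E + P E ** Z ** G))) (sgn (P E)) * inverse (norm (P E))))) (at E)"
    using \<open>P E \<noteq> 0\<close>
    by (intro Deriv.has_derivative_inverse has_derivative_compose[OF P has_derivative_norm]) auto
  also have "(\<lambda>Z. - (inverse (norm (P E))
        * inner (- (\<epsilon> *\<^sub>R (G ** Z ** P E + P E ** Z ** G))) (sgn (P E)) * inverse (norm (P E))))
      = (\<lambda>Z. inner Z ((\<epsilon> * f) *\<^sub>R S))"
  proof
    fix Z
    have "inner (P E) (G ** Z ** P E) = inner (P E ** ctranspose (P E)) (G ** Z)"
      by (rule inner_matrix_mul_right)
    also have "\<dots> = inner (ctranspose G ** (P E ** ctranspose (P E))) Z"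
      by (rule inner_matrix_mul_left)
    also have "\<dots> = (inverse f)\<^sup>2 * inner (ctranspose G ** outer (X E) (X E)) Z"
      using XY[OF \<open>E \<in> U\<close>] by (simp add: P_def eigenprojection_mul_ctranspose matrix_mul_scaleR_right
          f_def overlap_def X_def Y_def)
    finally have 1: "inner (P E) (G ** Z ** P E)
      = (inverse f)\<^sup>2 * inner (ctranspose G ** outer (X E) (X E)) Z" .
    have "inner (P E) (P E ** Z ** G) = inner (P E ** ctranspose G) (P E ** Z)"
      by (rule inner_matrix_mul_right)
    also have "\<dots> = inner ((ctranspose (P E) ** P E) ** ctranspose G) Z"
      by (simp add: inner_matrix_mul_left matrix_mul_assoc)
    also have "\<dots> = (inverse f)\<^sup>2 * inner (outer (Y E) (Y E) ** ctranspose G) Z"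
      using XY[OF \<open>E \<in> U\<close>] by (simp add: P_def eigenprojection_mul_ctranspose matrix_mul_scaleR_left
          f_def overlap_def X_def Y_def)
    finally have 2: "inner (P E) (P E ** Z ** G)
      = (inverse f)\<^sup>2 * inner (outer (Y E) (Y E) ** ctranspose G) Z" .
    have "S = outer (Y E) (Y E) ** ctranspose G + ctranspose G ** outer (X E) (X E)"
      by (simp add: S_def S_matrix_def Let_def X_def Y_def G_def)
    then have 3: "inner (G ** Z ** P E + P E ** Z ** G) (P E) = (inverse f)\<^sup>2 * inner Z S"
      by (simp add: inner_commute[of _ "P E"] inner_commute[of Z] inner_add_left inner_add_right 1 2
          distrib_left)
    have 4: "inner (- (\<epsilon> *\<^sub>R (G ** Z ** P E + P E ** Z ** G))) (sgn (P E))
        = - (\<epsilon> * (f * ((inverse f)\<^sup>2 * inner Z S)))"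
      using f by (simp add: sgn_div_norm 3 del: scaleR_add_right)
    show "- (inverse (norm (P E)) * inner (- (\<epsilon> *\<^sub>R (G ** Z ** P E + P E ** Z ** G))) (sgn (P E))
          * inverse (norm (P E))) = inner Z ((\<epsilon> * f) *\<^sub>R S)"
      unfolding 4 using f by (simp add: power2_eq_square)
  qed
  finally have "((\<lambda>F. inverse (norm (P F))) has_derivative (\<lambda>Z. inner Z ((\<epsilon> * f) *\<^sub>R S))) (at E)" .
  then have "((\<lambda>F. overlap x y (A + \<epsilon> *\<^sub>R F) (\<Lambda> F)) has_derivative (\<lambda>Z. inner Z ((\<epsilon> * f) *\<^sub>R S))) (at E)"
    by (rule has_derivative_transform_within_open) (use U' overlap in auto)
  then show ?thesis
    by (simp add: gderiv_def f_def S_def)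
qed

section \<open>The rank of the gradient and the geometry of the sphere\<close>

lemma exists_dual_vector:
  fixes b :: "'n::finite cvec"
  assumes "\<And>c. b \<noteq> c *s y"
  obtains v where "cinner v y = 0" "cinner v b = 1"
proof -
  define v where "v = b - (cinner y b / cinner y y) *s y"
  have "v \<noteq> 0"
    using assms by (simp add: v_def)
  have yv: "cinner y v = 0"
    by (cases "y = 0") (simp_all add: v_def cinner_diff_right cinner_scale_right)
  then have vy: "cinner v y = 0"
    by (metis cnj_cinner complex_cnj_zero)
  have "b = v + (cinner y b / cinner y y) *s y"
    by (simp add: v_def)
  then have "cinner v b = cinner v v + (cinner y b / cinner y y) * cinner v y"
    by (metis cinner_add_right cinner_scale_right)
  then have vb: "cinner v b = cinner v v"
    by (simp add: vy)
  show thesis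
  proof (rule that)
    show "cinner (inverse (cnj (cinner v v)) *s v) y = 0"
      by (simp add: cinner_scale_left vy)
    show "cinner (inverse (cnj (cinner v v)) *s v) b = 1"
      using \<open>v \<noteq> 0\<close> by (simp add: cinner_scale_left vb)
  qed
qed

text \<open>
  The rows are combinations of \<open>a\<^sup>H\<close> and \<open>x\<^sup>H\<close>.  Multiplying from the left by a vector
  orthogonal to one of \<open>y\<close>, \<open>b\<close> and not to the other recovers each of them.
\<close>

lemma rank_outer_plus_outer:
  fixes a b x y :: "'n::finite cvec"
  assumes a: "\<And>c. a \<noteq> c *s x" and "x \<noteq> 0" and b: "\<And>c. b \<noteq> c *s y" and "y \<noteq> 0"
  shows "rank (outer y a + outer b x) = 2"
proof -
  let ?S = "outer y a + outer b x"
  have comb: "vconj v v* ?S = cinner v y *s vconj a + cinner v b *s vconj x" for v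
    by (simp add: vec_eq_iff vconj_def vector_matrix_mult_def cinner_def sum_distrib_left
        sum_distrib_right sum.distrib algebra_simps)
  have in_span: "vconj v v* ?S \<in> vec.span (rows ?S)" for v
  proof -
    have "vconj v v* ?S = (\<Sum>i\<in>UNIV. vconj v $ i *s row i ?S)"
      by (simp add: vec_eq_iff vector_matrix_mult_def row_def mult.commute)
    also have "\<dots> \<in> vec.span (rows ?S)"
      by (intro vec.span_sum vec.span_scale vec.span_base) (auto simp: rows_def)
    finally show ?thesis .
  qed
  have y: "y \<noteq> c *s b" for c
  proof
    assume "y = c *s b"
    with \<open>y \<noteq> 0\<close> have "c \<noteq> 0" "b = inverse c *s y"
      by (auto simp: vector_smult_assoc)
    with b show False
      by blast
  qed
  obtain v1 where "cinner v1 y = 0" "cinner v1 b = 1"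
    using exists_dual_vector[OF b] by blast
  with comb[of v1] in_span[of v1] have x_in: "vconj x \<in> vec.span (rows ?S)"
    by simp
  obtain v2 where "cinner v2 b = 0" "cinner v2 y = 1"
    using exists_dual_vector[OF y] by blast
  with comb[of v2] in_span[of v2] have a_in: "vconj a \<in> vec.span (rows ?S)"
    by simp
  have "vec.span {vconj a, vconj x} = vec.span (rows ?S)"
  proof (rule antisym; rule vec.span_minimal)
    show "{vconj a, vconj x} \<subseteq> vec.span (rows ?S)"
      using x_in a_in by simp
    show "rows ?S \<subseteq> vec.span {vconj a, vconj x}"
    proof
      fix r
      assume "r \<in> rows ?S"
      then obtain i where "r = row i ?S"
        by (auto simp: rows_def)
      then have "r = y $ i *s vconj a + b $ i *s vconj x"
        by (simp add: vec_eq_iff row_def vconj_def)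
      then show "r \<in> vec.span {vconj a, vconj x}"
        by (simp only:) (intro vec.span_add vec.span_scale vec.span_base; simp)
    qed
  qed (rule vec.subspace_span)+
  then have "rank ?S = vec.dim {vconj a, vconj x}"
    by (metis row_rank_def_gen vec.dim_span)
  moreover have ax: "vconj a \<noteq> c *s vconj x" for c
  proof
    assume "vconj a = c *s vconj x"
    then have "a = cnj c *s x"
      by (simp add: vec_eq_iff vconj_def) (metis complex_cnj_cnj complex_cnj_mult)
    with a show False
      by blast
  qed
  moreover have "vconj x \<noteq> 0"
    using \<open>x \<noteq> 0\<close> by (simp add: vec_eq_iff vconj_def)
  then have "vec.independent {vconj a, vconj x}"
    using ax by (auto simp: vec.independent_insert vec.span_singleton)
  moreover have "vconj a \<noteq> vconj x"
    using ax[of 1] by simp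
  ultimately show ?thesis
    by (simp add: vec.dim_eq_card_independent)
qed

lemma rank_scaleR:
  fixes E :: "'n::finite cmat"
  assumes "c \<noteq> 0"
  shows "rank (c *\<^sub>R E) = rank E"
proof -
  have "row i (c *\<^sub>R E) = complex_of_real c *s row i E" for i
    by (simp add: row_def vec_eq_iff scaleR_conv_of_real[where 'a = complex])
  then have "rows (c *\<^sub>R E) = (\<lambda>v. complex_of_real c *s v) ` rows E"
    by (auto simp: rows_def)
  then have "vec.span (rows (c *\<^sub>R E)) = vec.span (rows E)"
    using assms vec.span_image_scale[of "rows E" "\<lambda>_. complex_of_real c"]
    by (simp add: rows_def full_SetCompr_eq)
  then show ?thesis
    by (metis row_rank_def_gen vec.dim_span)
qed

text \<open>
  The kernels of \<open>G\<close> and of its adjoint are the ranges of \<open>P\<close> and of its adjoint, that is, the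
  lines through \<open>x\<close> and through \<open>y\<close>.
\<close>

lemma spectral_pair_eigenvectors:
  assumes sp: "spectral_pair M \<mu> (eigenprojection x y) G" and yx: "cinner y x \<noteq> 0"
  shows "G *v x = 0" and "ctranspose G *v y = 0"
    and "eigenprojection x y *v (G *v v) = 0"
    and "ctranspose (eigenprojection x y) *v (ctranspose G *v v) = 0"
    and "G *v v = 0 \<Longrightarrow> v = eigenprojection x y *v v"
    and "ctranspose G *v v = 0 \<Longrightarrow> v = ctranspose (eigenprojection x y) *v v"
proof -
  let ?P = "eigenprojection x y"
  have GP: "G ** ?P = 0" "?P ** G = 0" and
    N: "G ** (M - mat \<mu>) = mat 1 - ?P" "(M - mat \<mu>) ** G = mat 1 - ?P"
    using sp by (auto simp: spectral_pair_def)
  have "cinner x y \<noteq> 0"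
    using yx by (metis cnj_cinner complex_cnj_zero)
  then have px: "?P *v x = x" "ctranspose ?P *v y = y"
    using yx by (simp_all add: eigenprojection_def ctranspose_outer outer_mul_vec vector_smult_assoc
        cinner_scale_left cnj_cinner)
  have GP': "ctranspose ?P ** ctranspose G = 0" "ctranspose G ** ctranspose ?P = 0"
    using GP by (simp_all add: ctranspose_mul[symmetric]) (simp_all add: vec_eq_iff)
  show "G *v x = 0" "ctranspose G *v y = 0"
    using px GP GP' by (metis matrix_vector_mul_assoc matrix_vector_mult_0)+
  show "?P *v (G *v v) = 0" "ctranspose ?P *v (ctranspose G *v v) = 0"
    by (simp_all add: matrix_vector_mul_assoc GP GP')
  show "v = ?P *v v" if "G *v v = 0"
  proof -
    have "((M - mat \<mu>) ** G) *v v = 0"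
      by (simp add: matrix_vector_mul_assoc[symmetric] that)
    then show ?thesis
      by (simp add: N matrix_vector_mult_diff_rdistrib)
  qed
  show "v = ctranspose ?P *v v" if "ctranspose G *v v = 0"
  proof -
    have "ctranspose (G ** (M - mat \<mu>)) *v v = 0"
      by (simp add: ctranspose_mul matrix_vector_mul_assoc[symmetric] that)
    then show ?thesis
      by (simp add: N matrix_vector_mult_diff_rdistrib ctranspose_diff ctranspose_mat)
  qed
qed

lemma eigenprojection_mul_vec: "eigenprojection x y *v v = (cinner y v / cinner y x) *s x"
  by (simp add: eigenprojection_def outer_mul_vec vector_smult_assoc divide_inverse)

lemma ctranspose_eigenprojection: "ctranspose (eigenprojection x y) = eigenprojection y x"
  by (simp add: eigenprojection_def ctranspose_outer vec_eq_iff cnj_cinner)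

lemma S_matrix_eq_outer:
  "S_matrix x y M \<mu> = (let G = group_inverse (M - mat \<mu>) in
    outer (y M \<mu>) (G *v y M \<mu>) + outer (ctranspose G *v x M \<mu>) (x M \<mu>))"
  by (simp add: S_matrix_def Let_def outer_mul mul_outer)

text \<open>
  In \<open>S = y (G y)\<^sup>H + (G\<^sup>H x) x\<^sup>H\<close>, the vector \<open>G y\<close> lies in the kernel of \<open>P\<close>, which
  contains no nonzero multiple of \<open>x\<close>; so \<open>G y\<close> is a multiple of \<open>x\<close> only if it is zero, and
  this happens only if \<open>y\<close> is a multiple of \<open>x\<close>.  The same applies to \<open>G\<^sup>H x\<close> and \<open>y\<close>.
\<close>

lemma rank_S_matrix:
  fixes M :: "'n::finite cmat"
  assumes xy: "eigvec_choice x y" and simple: "simple_eigenvalue M \<mu>"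
  shows "overlap x y M \<mu> < 1 \<Longrightarrow> rank (S_matrix x y M \<mu>) = 2"
    and "overlap x y M \<mu> = 1 \<Longrightarrow> S_matrix x y M \<mu> = 0"
proof -
  define X where "X = x M \<mu>"
  define Y where "Y = y M \<mu>"
  define G where "G = group_inverse (M - mat \<mu>)"
  have XY: "right_eigenvector M \<mu> X" "norm X = 1" "left_eigenvector M \<mu> Y" "norm Y = 1"
    using xy simple by (simp_all add: eigvec_choice_def X_def Y_def)
  have yx: "cinner Y X \<noteq> 0"
    using simple_eigenpair_cinner_nonzero[OF simple XY(1,3)] .
  have sp: "spectral_pair M \<mu> (eigenprojection X Y) G"
    unfolding G_def by (rule group_inverse_spectral_pair[OF simple XY(1,3)])
  note G = spectral_pair_eigenvectors[OF sp yx]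
  have S: "S_matrix x y M \<mu> = outer Y (G *v Y) + outer (ctranspose G *v X) X"
    by (simp add: S_matrix_eq_outer Let_def X_def Y_def G_def)
  have f: "overlap x y M \<mu> = cmod (cinner Y X)" "overlap x y M \<mu> = cmod (cinner X Y)"
    by (simp_all add: overlap_def X_def Y_def flip: cnj_cinner[of "y M \<mu>"])
  have unit: "\<exists>c. Y = c *s X \<Longrightarrow> overlap x y M \<mu> = 1" "\<exists>c. X = c *s Y \<Longrightarrow> overlap x y M \<mu> = 1"
  proof -
    assume "\<exists>c. Y = c *s X"
    then obtain c where "Y = c *s X" ..
    then show "overlap x y M \<mu> = 1"
      using XY by (simp add: f(1) cinner_scale_left cinner_self norm_mult norm_vec_scale)
  next
    assume "\<exists>c. X = c *s Y"
    then obtain c where "X = c *s Y" ..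
    then show "overlap x y M \<mu> = 1"
      using XY by (simp add: f(1) cinner_scale_right cinner_self norm_mult norm_vec_scale)
  qed
  show "S_matrix x y M \<mu> = 0" if "overlap x y M \<mu> = 1"
  proof -
    have "Y = cinner X Y *s X" "X = cinner Y X *s Y"
      using that XY cmod_cinner_eq_1_iff f by metis+
    then have "G *v Y = 0" "ctranspose G *v X = 0"
      using G(1,2) by (metis matrix_mul_vec_scale vec.scale_zero_right)+
    then show ?thesis
      by (simp add: S vec_eq_iff)
  qed
  show "rank (S_matrix x y M \<mu>) = 2" if "overlap x y M \<mu> < 1"
    unfolding S
  proof (rule rank_outer_plus_outer)
    show "X \<noteq> 0" "Y \<noteq> 0"
      using XY by auto
    show "G *v Y \<noteq> c *s X" for c
    proof
      assume "G *v Y = c *s X"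
      then have "eigenprojection X Y *v (G *v Y) = G *v Y"
        using yx by (simp add: eigenprojection_mul_vec cinner_scale_right)
      then have "Y = eigenprojection X Y *v Y"
        using G(3,5) by metis
      then show False
        using unit(1) that by (simp add: eigenprojection_mul_vec) (metis less_irrefl)
    qed
    show "ctranspose G *v X \<noteq> c *s Y" for c
    proof
      assume "ctranspose G *v X = c *s Y"
      then have "ctranspose (eigenprojection X Y) *v (ctranspose G *v X) = ctranspose G *v X"
        using yx by (simp add: ctranspose_eigenprojection eigenprojection_mul_vec cinner_scale_right
            flip: cnj_cinner[of Y X])
      then have "X = ctranspose (eigenprojection X Y) *v X"
        using G(4,6) by metis
      then show False
        using unit(2) that by (simp add: ctranspose_eigenprojection eigenprojection_mul_vec)
          (metis less_irrefl)
    qed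
  qed
qed

lemma orth_projection_tangent_space:
  assumes "norm E = 1"
  shows "orth_projection (tangent_space E) Z = Z - inner E Z *\<^sub>R E"
  unfolding orth_projection_def tangent_space_def inner_eq_Re_frob[symmetric]
proof (rule the_equality)
  have "inner E E = 1"
    using assms by (simp add: dot_square_norm)
  then show "Z - inner E Z *\<^sub>R E \<in> {Z. inner E Z = 0} \<and>
      (\<forall>W\<in>{Z. inner E Z = 0}. inner W (Z - (Z - inner E Z *\<^sub>R E)) = 0)"
    by (simp add: inner_diff_right inner_commute)
  fix P
  assume P: "P \<in> {Z. inner E Z = 0} \<and> (\<forall>W\<in>{Z. inner E Z = 0}. inner W (Z - P) = 0)"
  define W where "W = P - (Z - inner E Z *\<^sub>R E)"
  have EW: "inner E W = 0"
    using P \<open>inner E E = 1\<close> by (simp add: W_def inner_diff_right)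
  have "W = inner E Z *\<^sub>R E - (Z - P)"
    by (simp add: W_def)
  then have "inner W W = inner E Z * inner W E - inner W (Z - P)"
    by (metis inner_diff_right inner_scaleR_right)
  also have "\<dots> = 0"
    using P EW by (simp add: inner_commute[of W E])
  finally show "P = Z - inner E Z *\<^sub>R E"
    by (simp add: W_def)
qed

lemma sphere_curve:
  fixes E V :: "'a::real_inner"
  assumes "norm E = 1" "inner E V = 0"
  obtains c :: "real \<Rightarrow> 'a" where "c 0 = E" "\<And>s. norm (c s) = 1" "(c has_vector_derivative V) (at 0)"
proof
  define c where "c s = inverse (sqrt (1 + s\<^sup>2 * (norm V)\<^sup>2)) *\<^sub>R (E + s *\<^sub>R V)" for s
  show "c 0 = E"
    by (simp add: c_def)
  have pos: "1 + s\<^sup>2 * (norm V)\<^sup>2 > 0" for s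
    by (simp add: add_pos_nonneg)
  show "norm (c s) = 1" for s
  proof -
    have "(norm (E + s *\<^sub>R V))\<^sup>2 = 1 + s\<^sup>2 * (norm V)\<^sup>2"
      using assms by (simp add: power2_norm_eq_inner inner_add_left inner_add_right
          inner_commute[of V E] norm_eq_1 power2_eq_square[of s])
    then have "norm (E + s *\<^sub>R V) = sqrt (1 + s\<^sup>2 * (norm V)\<^sup>2)"
      by (metis abs_norm_cancel real_sqrt_abs)
    then show ?thesis
      using pos[of s] by (simp add: c_def)
  qed
  show "(c has_vector_derivative V) (at 0)"
    unfolding c_def
    by (auto intro!: derivative_eq_intros)
qed

section \<open>The flow on the sphere\<close>

lemma outer_zero_left: "outer 0 x = 0"
  by (simp add: vec_eq_iff)

lemma cinner_axis: "cinner x (axis i c) = cnj (x $ i) * c"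
  by (simp add: cinner_def axis_def if_distrib cong: if_cong)

lemma exists_orthogonal_vector:
  fixes x :: "'n::finite cvec"
  assumes "CARD('n) \<ge> 2"
  obtains w where "w \<noteq> 0" "cinner x w = 0"
proof (cases "x = 0")
  case True
  show thesis
    by (rule that[of "axis undefined 1"]) (use True in \<open>simp_all add: axis_eq_0_iff\<close>)
next
  case False
  then obtain k where k: "x $ k \<noteq> 0"
    by (auto simp: vec_eq_iff)
  have "UNIV \<noteq> {k}"
    using assms by (metis card.empty card.insert empty_iff finite.emptyI not_one_le_zero
        numeral_2_eq_2 One_nat_def Suc_n_not_le_n)
  then obtain j where j: "j \<noteq> k"
    by blast
  define w where "w = axis j (cnj (x $ k)) - axis k (cnj (x $ j))"
  have "w $ j \<noteq> 0"
    using j k by (simp add: w_def axis_def)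
  then have "w \<noteq> 0"
    by auto
  moreover have "cinner x w = 0"
    by (simp add: w_def cinner_diff_right cinner_axis)
  ultimately show thesis
    by (rule that)
qed

text \<open>
  A real-linear functional on the complex line through \<open>w\<close> has a nontrivial zero.
\<close>

lemma exists_tangent_outer:
  fixes E :: "'n::finite cmat" and x :: "'n cvec"
  assumes "CARD('n) \<ge> 2"
  obtains v where "v \<noteq> 0" "cinner x v = 0" "inner E (outer v x) = 0"
proof -
  obtain w where w: "w \<noteq> 0" "cinner x w = 0"
    using exists_orthogonal_vector[OF assms] .
  define a where "a = inner E (outer w x)"
  define b where "b = inner E (outer (\<i> *s w) x)"
  show thesis
  proof (cases "a = 0")
    case True
    then show thesis
      using w by (intro that[of w]) (simp_all add: a_def)
  next
    case False
    define v where "v = b *\<^sub>R w - a *\<^sub>R (\<i> *s w)"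
    have v: "v = (complex_of_real b - complex_of_real a * \<i>) *s w"
      by (simp add: v_def vec_eq_iff scaleR_conv_of_real[where 'a = complex] algebra_simps)
    have "complex_of_real b - complex_of_real a * \<i> \<noteq> 0"
      using False by (simp add: complex_eq_iff)
    then have "v \<noteq> 0"
      using w by (simp add: v)
    moreover have "cinner x v = 0"
      unfolding v cinner_scale_right w by simp
    moreover have "outer v x = b *\<^sub>R outer w x - a *\<^sub>R outer (\<i> *s w) x"
      by (simp add: v_def vec_eq_iff algebra_simps)
    then have "inner E (outer v x) = 0"
      by (simp add: inner_diff_right a_def b_def)
    ultimately show thesis
      by (rule that)
  qed
qed

text \<open>
  The eigenvalue at a fixed perturbation size, as a continuous function on the sphere.
\<close>

locale eigenvalue_sphere =
  fixes A :: "'n::finite cmat" and \<epsilon> :: real and lam :: "'n cmat \<Rightarrow> complex"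
    and x y :: "'n cmat \<Rightarrow> complex \<Rightarrow> 'n cvec" and f :: "'n cmat \<Rightarrow> real" and S :: "'n cmat \<Rightarrow> 'n cmat"
  assumes eps_pos: "\<epsilon> > 0"
    and lam_continuous: "continuous_on unit_sphere lam"
    and simple: "E \<in> unit_sphere \<Longrightarrow> simple_eigenvalue (A + \<epsilon> *\<^sub>R E) (lam E)"
    and choice: "eigvec_choice x y"
    and f_eq: "E \<in> unit_sphere \<Longrightarrow> f E = overlap x y (A + \<epsilon> *\<^sub>R E) (lam E)"
    and S_eq: "E \<in> unit_sphere \<Longrightarrow> S E = S_matrix x y (A + \<epsilon> *\<^sub>R E) (lam E)"
begin

lemma unit_sphere_iff: "E \<in> unit_sphere \<longleftrightarrow> norm E = 1"
  by (simp add: unit_sphere_def norm_eq_frob_norm)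

lemma eigvec:
  assumes "simple_eigenvalue M \<mu>"
  shows "right_eigenvector M \<mu> (x M \<mu>)" "norm (x M \<mu>) = 1"
    "left_eigenvector M \<mu> (y M \<mu>)" "norm (y M \<mu>) = 1"
  using choice assms by (auto simp: eigvec_choice_def)

lemma f_pos: "E \<in> unit_sphere \<Longrightarrow> f E > 0"
  using simple_eigenpair_cinner_nonzero[OF simple eigvec(1)[OF simple] eigvec(3)[OF simple]]
  by (simp add: f_eq overlap_def)

lemma f_le_1: "E \<in> unit_sphere \<Longrightarrow> f E \<le> 1"
  using cmod_cinner_le_1[OF eigvec(2)[OF simple] eigvec(4)[OF simple]]
  by (simp add: f_eq overlap_def)

lemma rank_S: "E \<in> unit_sphere \<Longrightarrow> f E < 1 \<Longrightarrow> rank (S E) = 2"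
  and S_eq_0: "E \<in> unit_sphere \<Longrightarrow> f E = 1 \<Longrightarrow> S E = 0"
  using rank_S_matrix[OF choice simple] by (simp_all add: f_eq S_eq)

lemma continuation_exists: "E \<in> unit_sphere \<Longrightarrow> \<exists>U \<Lambda>. ambient_continuation A \<epsilon> lam E U \<Lambda>"
  by (rule ambient_continuation_exists[OF lam_continuous _ simple])

lemma gradient:
  assumes "E \<in> unit_sphere" "ambient_continuation A \<epsilon> lam E U \<Lambda>"
  shows "GDERIV (\<lambda>F. overlap x y (A + \<epsilon> *\<^sub>R F) (\<Lambda> F)) E :> (\<epsilon> * f E) *\<^sub>R S E"
proof -
  have "\<Lambda> E = lam E"
    using assms by (auto simp: ambient_continuation_def)
  then show ?thesis
    using gderiv_overlap[OF choice assms(2)] assms(1) by (simp add: f_eq S_eq)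
qed

lemma flow_rhs_eq: "flow_rhs S E = - (S E - inner E (S E) *\<^sub>R E)"
  by (simp add: flow_rhs_def inner_eq_Re_frob)

lemma flow_rhs_orthogonal: "E \<in> unit_sphere \<Longrightarrow> inner E (flow_rhs S E) = 0"
  by (simp add: flow_rhs_eq inner_diff_right unit_sphere_iff norm_eq_1)

lemma inner_flow_rhs: "E \<in> unit_sphere \<Longrightarrow> inner (flow_rhs S E) (S E) = - (norm (flow_rhs S E))\<^sup>2"
proof -
  assume E: "E \<in> unit_sphere"
  have "S E = inner E (S E) *\<^sub>R E - flow_rhs S E"
    by (simp add: flow_rhs_eq)
  then have "inner (flow_rhs S E) (S E)
      = inner E (S E) * inner (flow_rhs S E) E - inner (flow_rhs S E) (flow_rhs S E)"
    by (metis inner_diff_right inner_scaleR_right)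
  then show ?thesis
    using flow_rhs_orthogonal[OF E] by (simp add: inner_commute[of "flow_rhs S E" E] power2_norm_eq_inner)
qed

lemma flow_rhs_antiparallel:
  assumes "E \<in> unit_sphere"
  shows "\<exists>c>0. flow_rhs S E = - (c *\<^sub>R orth_projection (tangent_space E) ((\<epsilon> * f E) *\<^sub>R S E))"
proof (intro exI conjI)
  show "inverse (\<epsilon> * f E) > 0"
    using eps_pos f_pos[OF assms] by simp
  show "flow_rhs S E = - (inverse (\<epsilon> * f E) *\<^sub>R orth_projection (tangent_space E) ((\<epsilon> * f E) *\<^sub>R S E))"
  proof -
    have "orth_projection (tangent_space E) ((\<epsilon> * f E) *\<^sub>R S E)
        = (\<epsilon> * f E) *\<^sub>R (S E - inner E (S E) *\<^sub>R E)"
      using assms by (simp add: orth_projection_tangent_space unit_sphere_iff scaleR_diff_right)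
    moreover have "inverse k *\<^sub>R (k *\<^sub>R Z) = Z" if "k > 0" for k and Z :: "'n cmat"
      using that by simp
    moreover have "\<epsilon> * f E > 0"
      using eps_pos f_pos[OF assms] by simp
    ultimately show ?thesis
      unfolding flow_rhs_eq by metis
  qed
qed

lemma eventually_in_nhd_along_curve:
  assumes "(\<gamma> has_vector_derivative v) (at t within T)" "t \<in> T" "open U" "\<gamma> t \<in> U"
    "\<And>s. s \<in> T \<Longrightarrow> \<gamma> s \<in> unit_sphere"
  shows "\<forall>\<^sub>F s in at t within T. \<gamma> s \<in> U \<inter> unit_sphere"
proof -
  have "continuous (at t within T) \<gamma>"
    using assms(1) by (rule has_vector_derivative_continuous)
  then have "(\<gamma> \<longlongrightarrow> \<gamma> t) (at t within T)"
    by (simp add: continuous_within)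
  then have "\<forall>\<^sub>F s in at t within T. \<gamma> s \<in> U"
    using assms(3,4) by (rule topological_tendstoD)
  moreover have "\<forall>\<^sub>F s in at t within T. s \<in> T"
    by (simp add: eventually_at_filter)
  ultimately show ?thesis
    by (rule eventually_elim2) (use assms(5) in auto)
qed

text \<open>
  A curve on the sphere stays for a while in the domain of an ambient continuation, where
  the chain rule applies.
\<close>

lemma f_along_curve:
  assumes \<gamma>: "(\<gamma> has_vector_derivative v) (at t within T)" "t \<in> T"
    "\<And>s. s \<in> T \<Longrightarrow> \<gamma> s \<in> unit_sphere"
  shows "((\<lambda>s. f (\<gamma> s)) has_real_derivative \<epsilon> * f (\<gamma> t) * inner v (S (\<gamma> t))) (at t within T)"
proof -
  have E: "\<gamma> t \<in> unit_sphere"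
    using \<gamma> by blast
  obtain U \<Lambda> where U: "ambient_continuation A \<epsilon> lam (\<gamma> t) U \<Lambda>"
    using continuation_exists[OF E] by blast
  then have eq: "f F = overlap x y (A + \<epsilon> *\<^sub>R F) (\<Lambda> F)" if "F \<in> U \<inter> unit_sphere" for F
    using that by (auto simp: ambient_continuation_def f_eq)
  have U': "open U" "\<gamma> t \<in> U"
    using U by (auto simp: ambient_continuation_def)
  have "((\<lambda>s. overlap x y (A + \<epsilon> *\<^sub>R \<gamma> s) (\<Lambda> (\<gamma> s))) has_derivative
      (\<lambda>h. inner (h *\<^sub>R v) ((\<epsilon> * f (\<gamma> t)) *\<^sub>R S (\<gamma> t)))) (at t within T)"
    using has_derivative_compose[OF \<gamma>(1)[unfolded has_vector_derivative_def]
        gradient[OF E U, unfolded gderiv_def]] .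
  then have "((\<lambda>s. f (\<gamma> s)) has_derivative
      (\<lambda>h. inner (h *\<^sub>R v) ((\<epsilon> * f (\<gamma> t)) *\<^sub>R S (\<gamma> t)))) (at t within T)"
  proof (rule has_derivative_transform_eventually)
    show "\<forall>\<^sub>F s in at t within T. overlap x y (A + \<epsilon> *\<^sub>R \<gamma> s) (\<Lambda> (\<gamma> s)) = f (\<gamma> s)"
      using eventually_in_nhd_along_curve[OF \<gamma>(1,2) U'] \<gamma>(3) by (auto simp: eq elim: eventually_mono)
  qed (use eq E U' \<gamma> in auto)
  then show ?thesis
    by (rule has_derivative_imp_has_field_derivative) (simp add: mult_ac)
qed

lemma flow_derivative:
  assumes "flow_solution S T \<gamma>" "t \<in> T"
  shows "((\<lambda>s. f (\<gamma> s)) has_real_derivative - \<epsilon> * f (\<gamma> t) * (norm (flow_rhs S (\<gamma> t)))\<^sup>2) (at t within T)"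
  using f_along_curve[of \<gamma> "flow_rhs S (\<gamma> t)" t T] assms
  by (simp add: flow_solution_def inner_flow_rhs)

lemma flow_stationary_iff:
  assumes "flow_solution S T \<gamma>" "t \<in> T"
  shows "((\<lambda>s. f (\<gamma> s)) has_real_derivative 0) (at t within T)
    \<longleftrightarrow> (\<gamma> has_vector_derivative 0) (at t within T)"
proof -
  have T: "is_interval T" "interior T \<noteq> {}"
    and \<gamma>: "\<gamma> t \<in> unit_sphere" "(\<gamma> has_vector_derivative flow_rhs S (\<gamma> t)) (at t within T)"
    using assms by (auto simp: flow_solution_def)
  \<comment> \<open>Derivatives within \<open>T\<close> are unique because the interval \<open>T\<close> is not a single point.\<close>
  have nontrivial: "at t within T \<noteq> bot"
  proof
    assume "at t within T = bot"
    then have "\<not> t islimpt T"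
      by (simp add: trivial_limit_within)
    then have "T = {t}"
      using T(1) assms(2) is_interval_connected connected_imp_perfect by blast
    then show False
      using T(2) by simp
  qed
  have "((\<lambda>s. f (\<gamma> s)) has_real_derivative 0) (at t within T) \<longleftrightarrow> flow_rhs S (\<gamma> t) = 0"
  proof
    assume "((\<lambda>s. f (\<gamma> s)) has_real_derivative 0) (at t within T)"
    then have "- \<epsilon> * f (\<gamma> t) * (norm (flow_rhs S (\<gamma> t)))\<^sup>2 = 0"
      using flow_derivative[OF assms] nontrivial has_field_derivative_unique by metis
    then show "flow_rhs S (\<gamma> t) = 0"
      using eps_pos f_pos[OF \<gamma>(1)] by simp
  next
    assume "flow_rhs S (\<gamma> t) = 0"
    then show "((\<lambda>s. f (\<gamma> s)) has_real_derivative 0) (at t within T)"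
      using flow_derivative[OF assms] by simp
  qed
  also have "\<dots> \<longleftrightarrow> (\<gamma> has_vector_derivative 0) (at t within T)"
    using \<gamma>(2) nontrivial vector_derivative_unique_within by metis
  finally show ?thesis .
qed

lemma equilibrium_rank:
  assumes "E \<in> unit_sphere" "flow_rhs S E = 0" "f E < 1"
  shows "rank E = 2"
proof -
  have S: "S E = inner E (S E) *\<^sub>R E"
    using assms(2) by (simp add: flow_rhs_eq)
  have "rank (S E) = 2"
    by (rule rank_S[OF assms(1,3)])
  moreover have "inner E (S E) \<noteq> 0"
  proof
    assume "inner E (S E) = 0"
    then have "rank (S E) = 0"
      using S by (simp add: row_rank_def_gen rows_def row_def vec.dim_eq_0) (auto simp: vec_eq_iff)
    with \<open>rank (S E) = 2\<close> show False
      by simp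
  qed
  ultimately show ?thesis
    by (metis S rank_scaleR)
qed

lemma minimizer_along_curve:
  assumes "sphere_minimizer f E" "c 0 = E" "\<And>s. norm (c s) = 1" "(c has_vector_derivative V) (at 0)"
  obtains d where "d > 0" "\<And>s. \<bar>s\<bar> < d \<Longrightarrow> f E \<le> f (c s)"
proof -
  obtain d where d: "d > 0" "\<And>F. F \<in> unit_sphere \<Longrightarrow> norm (F - E) < d \<Longrightarrow> f E \<le> f F"
    using assms(1) by (auto simp: sphere_minimizer_def norm_eq_frob_norm)
  have "isCont c 0"
    using assms(4) by (rule has_vector_derivative_continuous)
  then obtain e where "e > 0" "\<And>s. \<bar>s\<bar> < e \<Longrightarrow> norm (c s - E) < d"
    using d(1) assms(2) unfolding continuous_at_eps_delta by (auto simp: dist_norm)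
  then show thesis
    using d(2) assms(3) by (intro that[of e]) (auto simp: unit_sphere_iff)
qed

text \<open>
  Leaving \<open>E\<close> in the direction of the flow would decrease \<open>f\<close> at first order.
\<close>

lemma minimizer_equilibrium:
  assumes "sphere_minimizer f E"
  shows "flow_rhs S E = 0"
proof -
  have E: "E \<in> unit_sphere"
    using assms by (simp add: sphere_minimizer_def)
  obtain c where c: "c 0 = E" "\<And>s. norm (c s) = 1" "(c has_vector_derivative flow_rhs S E) (at (0::real))"
    using sphere_curve[of E "flow_rhs S E"] E flow_rhs_orthogonal[OF E] by (metis unit_sphere_iff)
  have deriv: "((\<lambda>s. f (c s)) has_real_derivative \<epsilon> * f E * - (norm (flow_rhs S E))\<^sup>2) (at 0)"
    using f_along_curve[OF c(3)] c(1,2) inner_flow_rhs[OF E] by (simp add: unit_sphere_iff)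
  obtain d where "d > 0" "\<And>s. \<bar>s\<bar> < d \<Longrightarrow> f E \<le> f (c s)"
    using minimizer_along_curve[OF assms c] by blast
  then have "\<epsilon> * f E * - (norm (flow_rhs S E))\<^sup>2 = 0"
    by (intro DERIV_local_min[OF deriv]) (auto simp: c(1))
  then show ?thesis
    using eps_pos f_pos[OF E] by simp
qed

text \<open>
  A local minimum with value \<open>1\<close> forces \<open>f = 1\<close> nearby, because \<open>f\<close> never exceeds \<open>1\<close>.  Then the
  eigenprojections are Hermitian along every curve on the sphere through \<open>E\<close>, and so are their
  derivatives.  In a direction \<open>v x\<^sup>H\<close> with \<open>v\<close> orthogonal to \<open>x\<close>, however, the derivative is a
  multiple of \<open>(G v) x\<^sup>H\<close>, which is Hermitian only if \<open>G v = 0\<close>, hence \<open>v = 0\<close>.  From dimension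
  two on, such a direction tangent to the sphere exists.
\<close>

lemma minimizer_less_1:
  assumes "CARD('n) \<ge> 2" and min: "sphere_minimizer f E"
  shows "f E < 1"
proof (rule ccontr)
  assume "\<not> f E < 1"
  have E: "E \<in> unit_sphere"
    using min by (simp add: sphere_minimizer_def)
  obtain U \<Lambda> where U: "ambient_continuation A \<epsilon> lam E U \<Lambda>"
    using continuation_exists[OF E] by blast
  then have U': "open U" "E \<in> U" "continuous_on U \<Lambda>"
    and simple': "\<And>F. F \<in> U \<Longrightarrow> simple_eigenvalue (A + \<epsilon> *\<^sub>R F) (\<Lambda> F)"
    and \<Lambda>: "\<And>F. F \<in> U \<inter> unit_sphere \<Longrightarrow> \<Lambda> F = lam F"
    by (auto simp: ambient_continuation_def)
  define X where "X F = x (A + \<epsilon> *\<^sub>R F) (\<Lambda> F)" for F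
  define Y where "Y F = y (A + \<epsilon> *\<^sub>R F) (\<Lambda> F)" for F
  define P where "P F = eigenprojection (X F) (Y F)" for F
  define G where "G = group_inverse (A + \<epsilon> *\<^sub>R E - mat (\<Lambda> E))"
  have XY: "right_eigenvector (A + \<epsilon> *\<^sub>R F) (\<Lambda> F) (X F)" "norm (X F) = 1"
    "left_eigenvector (A + \<epsilon> *\<^sub>R F) (\<Lambda> F) (Y F)" "norm (Y F) = 1" if "F \<in> U" for F
    using eigvec[OF simple'[OF that]] by (simp_all add: X_def Y_def)
  have hermitian: "P F = outer (X F) (X F)" if "F \<in> U \<inter> unit_sphere" "1 \<le> f F" for F
  proof -
    have one: "cmod (cinner (Y F) (X F)) = 1"
      using that f_le_1[of F] \<Lambda>[OF that(1)] by (simp add: f_eq overlap_def X_def Y_def)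
    have "Y F = cinner (X F) (Y F) *s X F"
      using XY[of F] that one by (simp add: cmod_cinner_eq_1_iff)
    moreover have nz: "cinner (Y F) (X F) \<noteq> 0"
      using one by auto
    moreover have "(X F $ i / cinner (Y F) (X F)) * cnj (cinner (X F) (Y F) * X F $ j)
        = X F $ i * cnj (X F $ j)" for i j
      using nz by (simp add: cnj_cinner)
    ultimately have "(X F $ i / cinner (Y F) (X F)) * cnj (Y F $ j) = X F $ i * cnj (X F $ j)" for i j
      by (metis vector_smult_component)
    then show ?thesis
      by (simp add: P_def eigenprojection_def vec_eq_iff divide_inverse mult_ac)
  qed
  have PE: "P E = outer (X E) (X E)"
    using E U' \<open>\<not> f E < 1\<close> by (intro hermitian) auto
  have XX: "cinner (X E) (X E) = 1"
    using XY U' by (simp add: cinner_self)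
  obtain v where v: "v \<noteq> 0" "cinner (X E) v = 0" "inner E (outer v (X E)) = 0"
    using exists_tangent_outer[OF assms(1)] .
  have Pv: "P E *v v = 0"
    by (simp add: PE outer_mul_vec v)
  let ?Z = "outer v (X E)"
  obtain c where c: "c 0 = E" "\<And>s. norm (c s) = 1" "(c has_vector_derivative ?Z) (at (0::real))"
    using sphere_curve[of E ?Z] E v by (metis unit_sphere_iff)
  obtain d where d: "d > 0" "\<And>s. \<bar>s\<bar> < d \<Longrightarrow> f E \<le> f (c s)"
    using minimizer_along_curve[OF min c] by blast
  define D where "D h = - (\<epsilon> *\<^sub>R (G ** (h *\<^sub>R ?Z) ** P E + P E ** (h *\<^sub>R ?Z) ** G))" for h
  have P: "(P has_derivative (\<lambda>Z. - (\<epsilon> *\<^sub>R (G ** Z ** P E + P E ** Z ** G)))) (at E)"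
    unfolding P_def G_def
    by (rule eigenprojection_has_derivative[OF U' simple' XY(1) XY(3)])
  have PD: "((\<lambda>s. P (c s)) has_derivative D) (at 0)"
    unfolding D_def
    by (rule has_derivative_compose[OF c(3)[unfolded has_vector_derivative_def]])
       (use P c(1) in simp)
  have "bounded_linear (ctranspose :: 'n cmat \<Rightarrow> 'n cmat)"
    using linear_ctranspose by (simp add: linear_conv_bounded_linear)
  then have "((\<lambda>s. ctranspose (P (c s))) has_derivative (\<lambda>h. ctranspose (D h))) (at 0)"
    using PD by (rule bounded_linear.has_derivative)
  then have "((\<lambda>s. P (c s)) has_derivative (\<lambda>h. ctranspose (D h))) (at 0)"
  proof (rule has_derivative_transform_eventually)
    have "\<forall>\<^sub>F s in at 0. c s \<in> U \<inter> unit_sphere"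
      using eventually_in_nhd_along_curve[OF c(3) _ U'(1)] c U'(2) by (simp add: unit_sphere_iff)
    moreover have "\<forall>\<^sub>F s in at (0::real). \<bar>s\<bar> < d"
      using d(1) by (auto simp: eventually_at dist_norm)
    ultimately show "\<forall>\<^sub>F s in at 0. ctranspose (P (c s)) = P (c s)"
    proof eventually_elim
      case (elim s)
      then have "1 \<le> f (c s)"
        using d(2) \<open>\<not> f E < 1\<close> by force
      then show ?case
        using hermitian elim by (simp add: ctranspose_outer)
    qed
  qed (simp_all add: c PE ctranspose_outer)
  then have "D = (\<lambda>h. ctranspose (D h))"
    using PD by (intro has_derivative_unique)
  then have "D 1 = ctranspose (D 1)"
    by metis
  moreover have "D 1 = - (\<epsilon> *\<^sub>R outer (G *v v) (X E))"
    by (simp add: D_def mul_outer Pv outer_zero_left matrix_mul_zero_left) (simp add: PE mul_outer outer_mul_vec XX outer_mul_outer)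
  ultimately have "\<epsilon> *\<^sub>R outer (G *v v) (X E) = \<epsilon> *\<^sub>R outer (X E) (G *v v)"
    by (simp add: ctranspose_minus ctranspose_scaleR ctranspose_outer)
  then have "outer (G *v v) (X E) = outer (X E) (G *v v)"
    using eps_pos by simp
  then have "outer (G *v v) (X E) *v X E = outer (X E) (G *v v) *v X E"
    by simp
  then have Gv: "G *v v = cinner (G *v v) (X E) *s X E"
    by (simp add: outer_mul_vec XX)
  have sp: "spectral_pair (A + \<epsilon> *\<^sub>R E) (\<Lambda> E) (eigenprojection (X E) (Y E)) G"
    unfolding G_def by (intro group_inverse_spectral_pair simple' XY U')
  note G = spectral_pair_eigenvectors[OF sp simple_eigenpair_cinner_nonzero[OF simple' XY(1,3)],
      OF U'(2) U'(2) U'(2), folded P_def]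
  have "P E *v (cinner (G *v v) (X E) *s X E) = cinner (G *v v) (X E) *s X E"
    by (simp add: PE outer_mul_vec cinner_scale_right XX)
  then have "G *v v = 0"
    using G(3) Gv by metis
  then have "v = 0"
    using G(5) Pv by metis
  with v show False
    by simp
qed

end

theorem theorem3p1:
  fixes A :: "complex ^ 'n ^ 'n"
    and lam0 :: complex
    and \<epsilon>0 \<epsilon> :: real
    and lam :: "real \<Rightarrow> complex ^ 'n ^ 'n \<Rightarrow> complex"
    and x y :: "complex ^ 'n ^ 'n \<Rightarrow> complex \<Rightarrow> complex ^ 'n"
    and f :: "complex ^ 'n ^ 'n \<Rightarrow> real"
    and S :: "complex ^ 'n ^ 'n \<Rightarrow> complex ^ 'n ^ 'n"
  assumes simple: "simple_eigenvalue A lam0"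
    and eps0: "\<epsilon>0 > 0"
    and lam: "eigenvalue_continuation A lam0 \<epsilon>0 lam"
    and eps: "\<epsilon> \<in> {0<..\<epsilon>0}"
    and xy: "eigvec_choice x y"
    and f: "\<And>E. E \<in> unit_sphere \<Longrightarrow> f E = overlap x y (A + \<epsilon> *\<^sub>R E) (lam \<epsilon> E)"
    and S: "\<And>E. E \<in> unit_sphere \<Longrightarrow> S E = S_matrix x y (A + \<epsilon> *\<^sub>R E) (lam \<epsilon> E)"
  shows
    "(\<forall>E\<in>unit_sphere.
        (\<exists>U \<Lambda>. ambient_continuation A \<epsilon> (lam \<epsilon>) E U \<Lambda>) \<and>
        (\<forall>U \<Lambda>. ambient_continuation A \<epsilon> (lam \<epsilon>) E U \<Lambda> \<longrightarrow>
           (\<exists>g. (GDERIV (\<lambda>F. overlap x y (A + \<epsilon> *\<^sub>R F) (\<Lambda> F)) E :> g) \<and>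
                (\<exists>c>0. flow_rhs S E = - (c *\<^sub>R orth_projection (tangent_space E) g)))))
     \<and> (\<forall>T \<gamma>. flow_solution S T \<gamma> \<longrightarrow>
        (\<forall>t\<in>T.
           ((\<lambda>s. f (\<gamma> s)) has_real_derivative
              - \<epsilon> * f (\<gamma> t) * (frob_norm (S (\<gamma> t) - Re (frob (\<gamma> t) (S (\<gamma> t))) *\<^sub>R \<gamma> t))\<^sup>2)
             (at t within T) \<and>
           (((\<lambda>s. f (\<gamma> s)) has_real_derivative 0) (at t within T) \<longleftrightarrow>
            (\<gamma> has_vector_derivative 0) (at t within T))))
     \<and> (\<forall>E\<in>unit_sphere.
          (f E < 1 \<longrightarrow> rank (S E) = 2) \<and> (f E = 1 \<longrightarrow> S E = 0))
     \<and> (\<forall>E\<in>unit_sphere. flow_rhs S E = 0 \<and> f E < 1 \<longrightarrow> rank E = 2)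
     \<and> (\<forall>E. sphere_minimizer f E \<and> f E < 1 \<longrightarrow> flow_rhs S E = 0 \<and> rank E = 2)
     \<and> (CARD('n) \<ge> 2 \<longrightarrow> (\<forall>E. sphere_minimizer f E \<longrightarrow> f E < 1))"
proof -
  interpret eigenvalue_sphere A \<epsilon> "lam \<epsilon>" x y f S
  proof
    show "\<epsilon> > 0"
      using eps by simp
    have "continuous_on unit_sphere ((\<lambda>(\<epsilon>, E). lam \<epsilon> E) \<circ> Pair \<epsilon>)"
      using lam eps unfolding eigenvalue_continuation_def
      by (intro continuous_on_compose continuous_intros) (auto elim!: continuous_on_subset)
    then show "continuous_on unit_sphere (lam \<epsilon>)"
      by (simp add: o_def)
    show "simple_eigenvalue (A + \<epsilon> *\<^sub>R E) (lam \<epsilon> E)" if "E \<in> unit_sphere" for E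
      using lam eps that by (simp add: eigenvalue_continuation_def)
  qed (use xy f S in auto)
  have grad: "\<forall>E\<in>unit_sphere.
        (\<exists>U \<Lambda>. ambient_continuation A \<epsilon> (lam \<epsilon>) E U \<Lambda>) \<and>
        (\<forall>U \<Lambda>. ambient_continuation A \<epsilon> (lam \<epsilon>) E U \<Lambda> \<longrightarrow>
           (\<exists>g. (GDERIV (\<lambda>F. overlap x y (A + \<epsilon> *\<^sub>R F) (\<Lambda> F)) E :> g) \<and>
                (\<exists>c>0. flow_rhs S E = - (c *\<^sub>R orth_projection (tangent_space E) g))))"
    using continuation_exists gradient flow_rhs_antiparallel by blast
  have flow: "\<forall>T \<gamma>. flow_solution S T \<gamma> \<longrightarrow>
        (\<forall>t\<in>T.
           ((\<lambda>s. f (\<gamma> s)) has_real_derivative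
              - \<epsilon> * f (\<gamma> t) * (frob_norm (S (\<gamma> t) - Re (frob (\<gamma> t) (S (\<gamma> t))) *\<^sub>R \<gamma> t))\<^sup>2)
             (at t within T) \<and>
           (((\<lambda>s. f (\<gamma> s)) has_real_derivative 0) (at t within T) \<longleftrightarrow>
            (\<gamma> has_vector_derivative 0) (at t within T)))"
    using flow_derivative flow_stationary_iff
    by (simp add: flow_rhs_eq norm_minus_commute inner_eq_Re_frob norm_eq_frob_norm[symmetric])
  have rank: "\<forall>E\<in>unit_sphere. (f E < 1 \<longrightarrow> rank (S E) = 2) \<and> (f E = 1 \<longrightarrow> S E = 0)"
    using rank_S S_eq_0 by blast
  have equilibria: "\<forall>E\<in>unit_sphere. flow_rhs S E = 0 \<and> f E < 1 \<longrightarrow> rank E = 2"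
    using equilibrium_rank by blast
  have minimizers: "\<forall>E. sphere_minimizer f E \<and> f E < 1 \<longrightarrow> flow_rhs S E = 0 \<and> rank E = 2"
    using equilibria minimizer_equilibrium by (simp add: sphere_minimizer_def)
  show ?thesis
    using grad flow rank equilibria minimizers minimizer_less_1 by blast
qed

end
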